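(* There is a polynomial-time algorithm that, given an interval graph $G$ and an integer $k$, decides whether the $k$-TS reconfiguration graph $TS_k(G)$ is connected.
   Context: An interval graph is the intersection graph of a family of intervals of the real line. A $k$-independent set is an independent set of size exactly $k$. The $k$-TS reconfiguration graph $TS_k(G)$ has as vertices the $k$-independent sets of $G$, and two $k$-independent sets $I,J$ are adjacent if $I\setminus J=\{v\}$, $J\setminus I=\{u\}$ and $uv$ is an edge of $G$. *)

theory Defs
  imports
    "HOL-Analysis.Analysis"
    "HOL-Library.Log_Nat"
    "HOL-Computational_Algebra.Polynomial"
    "Graph_Theory.Graph_Theory"
begin

section \<open>Interval graphs and token sliding\<close>

text \<open>
  A finite simple undirected graph is a \<^const>\<open>pair_graph\<close>: every edge is
  represented by its two opposite arcs.
\<close>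

definition interval_graph :: "'a pair_pre_digraph \<Rightarrow> bool" where
  "interval_graph G \<longleftrightarrow> pair_graph G \<and>
     (\<exists>I :: 'a \<Rightarrow> real set.
        (\<forall>v \<in> pverts G. is_interval (I v) \<and> I v \<noteq> {}) \<and>
        (\<forall>u \<in> pverts G. \<forall>v \<in> pverts G. u \<noteq> v \<longrightarrow>
           ((u, v) \<in> parcs G \<longleftrightarrow> I u \<inter> I v \<noteq> {})))"

definition k_independent_set :: "'a pair_pre_digraph \<Rightarrow> nat \<Rightarrow> 'a set \<Rightarrow> bool" where
  "k_independent_set G k S \<longleftrightarrow>
     S \<subseteq> pverts G \<and> (\<forall>u \<in> S. \<forall>v \<in> S. (u, v) \<notin> parcs G) \<and> finite S \<and> card S = k"

definition TS_graph :: "nat \<Rightarrow> 'a pair_pre_digraph \<Rightarrow> 'a set pair_pre_digraph" where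
  "TS_graph k G =
     \<lparr> pverts = {S. k_independent_set G k S},
       parcs = {(S, T). k_independent_set G k S \<and> k_independent_set G k T \<and>
                        (\<exists>u v. S - T = {v} \<and> T - S = {u} \<and> (u, v) \<in> parcs G)} \<rparr>"

text \<open>
  Connectedness of this graph is \<open>Digraph_Component.connected\<close>, which is false for the graph
  without vertices, i.e. when \<open>G\<close> has no \<open>k\<close>-independent set.
\<close>

lemma pair_graph_TS_graph:
  assumes "pair_graph G"
  shows "pair_graph (TS_graph k G)"
proof -
  interpret pair_graph G by fact
  have fin: "finite (pverts (TS_graph k G))"
    by (rule finite_subset[of _ "Pow (pverts G)"])
       (auto simp: TS_graph_def k_independent_set_def pair_finite_verts)
  have sub: "parcs (TS_graph k G) \<subseteq> pverts (TS_graph k G) \<times> pverts (TS_graph k G)"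
    by (auto simp: TS_graph_def)
  have G: "sym (parcs G)"
    using pair_sym_arcs by (simp add: symmetric_def)
  have "sym (parcs (TS_graph k G))"
  proof (rule symI)
    fix S T
    assume "(S, T) \<in> parcs (TS_graph k G)"
    then obtain u v where "k_independent_set G k S" "k_independent_set G k T"
      "S - T = {v}" "T - S = {u}" "(u, v) \<in> parcs G"
      by (auto simp: TS_graph_def)
    moreover from this(5) have "(v, u) \<in> parcs G"
      by (rule symD[OF G])
    ultimately show "(T, S) \<in> parcs (TS_graph k G)"
      unfolding TS_graph_def by simp
  qed
  moreover have "finite (parcs (TS_graph k G))"
    by (rule finite_subset[OF sub finite_cartesian_product[OF fin fin]])
  moreover have "fst e \<noteq> snd e" if "e \<in> parcs (TS_graph k G)" for e
    using that by (cases e) (auto simp: TS_graph_def)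
  moreover have "fst e \<in> pverts (TS_graph k G)" "snd e \<in> pverts (TS_graph k G)"
    if "e \<in> parcs (TS_graph k G)" for e
    using that sub by auto
  ultimately show ?thesis
    using fin by unfold_locales (simp_all add: symmetric_def)
qed

section \<open>Algorithms and polynomial time\<close>

text \<open>
  Algorithms are programs of a random access machine, written in structured form. A store
  consists of arrays of natural numbers; a scalar variable is cell \<open>0\<close> of an array. The only
  arithmetic operations are addition and truncated subtraction, and every operation costs one
  unit of time. Since \<open>t\<close> units of time lengthen the binary representation of the stored numbers
  by at most \<open>O(t)\<close> bits, such a machine and a Turing machine simulate each other with
  polynomial overhead. (A unit-cost multiplication would break this equivalence.)
\<close>

type_synonym vname = string
type_synonym store = "vname \<Rightarrow> nat \<Rightarrow> nat"

datatype aexp =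
    Num nat
  | Cell vname aexp
  | Plus aexp aexp
  | Minus aexp aexp

datatype bexp =
    Less aexp aexp
  | Neg bexp
  | Conj bexp bexp

datatype com =
    Skip
  | Assign vname aexp aexp
  | Seq com com
  | Cond bexp com com
  | While bexp com

primrec aval :: "aexp \<Rightarrow> store \<Rightarrow> nat" where
  "aval (Num n) s = n"
| "aval (Cell x e) s = s x (aval e s)"
| "aval (Plus e f) s = aval e s + aval f s"
| "aval (Minus e f) s = aval e s - aval f s"

primrec acost :: "aexp \<Rightarrow> nat" where
  "acost (Num n) = 1"
| "acost (Cell x e) = 1 + acost e"
| "acost (Plus e f) = 1 + acost e + acost f"
| "acost (Minus e f) = 1 + acost e + acost f"

primrec bval :: "bexp \<Rightarrow> store \<Rightarrow> bool" where
  "bval (Less e f) s \<longleftrightarrow> aval e s < aval f s"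
| "bval (Neg b) s \<longleftrightarrow> \<not> bval b s"
| "bval (Conj b c) s \<longleftrightarrow> bval b s \<and> bval c s"

primrec bcost :: "bexp \<Rightarrow> nat" where
  "bcost (Less e f) = 1 + acost e + acost f"
| "bcost (Neg b) = 1 + bcost b"
| "bcost (Conj b c) = 1 + bcost b + bcost c"

text \<open>
  \<open>exec c s t s'\<close>: started in store \<open>s\<close>, program \<open>c\<close> halts after \<open>t\<close> units of time in store
  \<open>s'\<close>. The command \<open>Assign x e f\<close> is the array assignment \<open>x[e] := f\<close>.
\<close>

inductive exec :: "com \<Rightarrow> store \<Rightarrow> nat \<Rightarrow> store \<Rightarrow> bool" where
  Skip: "exec Skip s 1 s"
| Assign: "exec (Assign x e f) s (1 + acost e + acost f)
             (s(x := (s x)(aval e s := aval f s)))"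
| Seq: "exec c s t s' \<Longrightarrow> exec d s' t' s'' \<Longrightarrow> exec (Seq c d) s (1 + t + t') s''"
| CondT: "bval b s \<Longrightarrow> exec c s t s' \<Longrightarrow> exec (Cond b c d) s (1 + bcost b + t) s'"
| CondF: "\<not> bval b s \<Longrightarrow> exec d s t s' \<Longrightarrow> exec (Cond b c d) s (1 + bcost b + t) s'"
| WhileF: "\<not> bval b s \<Longrightarrow> exec (While b c) s (1 + bcost b) s"
| WhileT: "bval b s \<Longrightarrow> exec c s t s' \<Longrightarrow> exec (While b c) s' t' s'' \<Longrightarrow>
             exec (While b c) s (1 + bcost b + t + t') s''"

inductive_cases SkipE: "exec Skip s t s'"
inductive_cases AssignE: "exec (Assign x e f) s t s'"
inductive_cases SeqE: "exec (Seq c d) s t s'"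
inductive_cases CondE: "exec (Cond b c d) s t s'"
inductive_cases WhileE: "exec (While b c) s t s'"

lemma exec_deterministic:
  "exec c s t s' \<Longrightarrow> exec c s u r \<Longrightarrow> t = u \<and> s' = r"
proof (induction arbitrary: u r rule: exec.induct)
  case (Seq c s t s' d t' s'')
  from Seq.prems show ?case by (rule SeqE) (use Seq.IH in force)
next
  case (CondT b s c t s' d)
  from CondT.prems show ?case by (rule CondE) (use CondT.hyps CondT.IH in force)+
next
  case (CondF b s d t s' c)
  from CondF.prems show ?case by (rule CondE) (use CondF.hyps CondF.IH in force)+
next
  case (WhileT b s c t s' t' s'')
  from WhileT.prems show ?case 
  proof (rule WhileE)
    assume "\<not> bval b s"
    with WhileT.hyps show ?thesis by simp
  next
    fix t1 r1 t2
    assume u: "u = Suc (bcost b + t1 + t2)" and c: "exec c s t1 r1" and w: "exec (While b c) r1 t2 r"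
    from WhileT.IH(1)[OF c] have "t = t1" "s' = r1" by simp_all
    with WhileT.IH(2) w u show ?thesis by force
  qed
next
  case (WhileF b s c)
  from WhileF.prems show ?case by (rule WhileE) (use WhileF.hyps in simp_all)
next
  case (Skip s)
  then show ?case by (rule SkipE) simp
next
  case (Assign x e f s)
  then show ?case by (rule AssignE) simp
qed

text \<open>
  A promise problem has instances in \<open>D\<close> (the program may behave arbitrarily outside \<open>D\<close>)
  and yes-instances \<open>P\<close>. The time bound is a polynomial in the size of the instance.
\<close>

definition polytime_decidable ::
    "('i \<Rightarrow> store) \<Rightarrow> ('i \<Rightarrow> nat) \<Rightarrow> 'i set \<Rightarrow> ('i \<Rightarrow> bool) \<Rightarrow> bool" where
  "polytime_decidable input input_size D P \<longleftrightarrow>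
     (\<exists>(c :: com) (p :: nat poly). \<forall>x \<in> D. \<exists>t s.
        exec c (input x) t s \<and> t \<le> poly p (input_size x) \<and>
        s ''out'' 0 = (if P x then 1 else 0))"

text \<open>
  Input graphs have vertices \<open>0, \<dots>, n - 1\<close> and are given by their adjacency matrix, stored
  row by row; cells beyond \<open>n * n\<close> are \<open>0\<close> because arcs join vertices.
\<close>

definition graph_nat_input :: "nat pair_pre_digraph \<times> nat \<Rightarrow> store" where
  "graph_nat_input = (\<lambda>(G, k). let n = card (pverts G) in
     (\<lambda>x i. 0)
       (''n'' := (\<lambda>i. 0)(0 := n),
        ''k'' := (\<lambda>i. 0)(0 := k),
        ''A'' := (\<lambda>i. if (i div n, i mod n) \<in> parcs G then 1 else 0)))"

text \<open>The number of bits of the input, with \<open>n\<close> and \<open>k\<close> written in binary.\<close>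

definition graph_nat_size :: "nat pair_pre_digraph \<times> nat \<Rightarrow> nat" where
  "graph_nat_size = (\<lambda>(G, k). let n = card (pverts G) in floorlog 2 n + floorlog 2 k + n * n)"

end

theory Submission
  imports Defs
begin

text \<open>
  In an interval graph the tokens keep their left-to-right order, so a configuration is a sorted
  list. Take the first token of a component to its leftmost reachable position \<open>y\<close>. Pinning it
  there and forgetting it projects the component onto a component of the remaining tokens in the
  part of the graph to the right of \<open>y\<close>; how far those tokens can give way decides where the first
  token can go. This room enters monotonically, so only its minimum over all components
  matters: whether \<open>y\<close> is the leftmost position of some component, the minimum room of a
  one larger number of tokens, and connectedness all satisfy recursions in the number of tokens.
  The intervals are not part of the input. Any transitive orientation of the complement of an
  interval graph is an interval order and serves instead; one is found by the lexicographic
  method of Hell and Huang. Orientation and recursion are first-order definable updates of binary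
  tables over the vertices, iterated polynomially often.
\<close>

section \<open>Sliding tokens on intervals\<close>

text \<open>Components can be exponentially many, so they are never listed. Why the least room
  suffices: \<open>y\<close> is the leftmost position of the first token in some component iff it
  cannot get left of \<open>y\<close> even while the tokens behind it give way only as far as their
  worst component on \<open>after S y\<close> allows; more room only opens more places. The other
  obstacles are these. Splitting off tokens must not create ever new ground sets:
  \<open>after (after S x) y = after S y\<close> for \<open>y\<close> in \<open>after S x\<close>,
  so table rows indexed by vertices suffice. Reachability is a transitive closure, but among
  intervals it is the absence of a gap, which a first-order formula expresses. Endpoints are
  unknown, but only a right end with a left end, or two right ends, are ever compared, and an
  orientation determines both comparisons. Directing the forcing classes arbitrarily could create
  directed triangles; the lexicographic rule prevents this. Finally \<open>k\<close>, written in
  binary, may be exponentially large, but more than \<open>n\<close> tokens have no configuration,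
  so \<open>n\<close> rounds are enough.\<close>

locale interval_family =
  fixes V :: "'a set" and l r :: "'a \<Rightarrow> nat"
  assumes finite_V: "finite V" and l_le_r: "v \<in> V \<Longrightarrow> l v \<le> r v"
begin

definition after :: "'a set \<Rightarrow> 'a \<Rightarrow> 'a set" where
  "after S y = {v \<in> S. r y < l v}"

text \<open>Lists instead of sets: once the first token is split off, the others form a
  configuration of the same kind on a smaller ground set, and every recursion below uses
  this.\<close>

primrec packed :: "'a set \<Rightarrow> 'a list \<Rightarrow> bool" where
  "packed S [] \<longleftrightarrow> True"
| "packed S (y # I) \<longleftrightarrow> y \<in> S \<and> packed (after S y) I"

text \<open>A slide may leave the configuration unchanged, since \<open>y = z\<close> is allowed.\<close>

inductive slide :: "'a list \<Rightarrow> 'a list \<Rightarrow> bool" where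
  slide_head: "l y \<le> r z \<Longrightarrow> l z \<le> r y \<Longrightarrow> slide (y # I) (z # I)"
| slide_tail: "slide I J \<Longrightarrow> slide (y # I) (y # J)"

definition move :: "'a set \<Rightarrow> 'a list \<Rightarrow> 'a list \<Rightarrow> bool" where
  "move S I J \<longleftrightarrow> packed S I \<and> packed S J \<and> slide I J"

abbreviation reach :: "'a set \<Rightarrow> 'a list \<Rightarrow> 'a list \<Rightarrow> bool" where
  "reach S \<equiv> (move S)\<^sup>*\<^sup>*"

definition before :: "'a \<Rightarrow> 'a list \<Rightarrow> bool" where
  "before v I \<longleftrightarrow> (\<forall>u \<in> set I. r v < l u)"

lemma after_subset: "after S y \<subseteq> S"
  by (auto simp: after_def)

lemma after_mono: "S \<subseteq> T \<Longrightarrow> after S y \<subseteq> after T y"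
  by (auto simp: after_def)

lemma after_antimono: "r x \<le> r y \<Longrightarrow> after S y \<subseteq> after S x"
  by (auto simp: after_def)

lemma packed_mono: "packed S I \<Longrightarrow> S \<subseteq> T \<Longrightarrow> packed T I"
proof (induction I arbitrary: S T)
  case (Cons y I)
  then show ?case using after_mono[of S T y] by auto
qed simp

lemma packed_subset: "packed S I \<Longrightarrow> set I \<subseteq> S"
proof (induction I arbitrary: S)
  case (Cons y I)
  then have "set I \<subseteq> after S y" by simp
  with Cons.prems show ?case using after_subset[of S y] by auto
qed simp

lemma packed_before: "packed (after S y) I \<Longrightarrow> before y I"
  using packed_subset[of "after S y" I] by (auto simp: before_def after_def)

text \<open>Only the head \<open>u\<close> needs checking. From \<open>r z < l u \<le> r u\<close>,
  whatever comes after \<open>u\<close> in \<open>S\<close> also comes after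
  \<open>z\<close>.\<close>

lemma packed_after:
  assumes "packed S I" "S \<subseteq> V" "before z I"
  shows "packed (after S z) I"
proof (cases I)
  case (Cons u I')
  have "r z < l u" "u \<in> S" using assms Cons by (auto simp: before_def)
  moreover have "l u \<le> r u" using \<open>u \<in> S\<close> assms(2) l_le_r by auto
  ultimately have "after S u \<subseteq> after (after S z) u" by (auto simp: after_def)
  with assms(1) Cons \<open>r z < l u\<close> show ?thesis
    by (auto simp: after_def[of S z] intro: packed_mono)
qed simp

lemma slide_sym: "slide I J \<Longrightarrow> slide J I"
  by (induction rule: slide.induct) (auto intro: slide.intros)

lemma slide_length: "slide I J \<Longrightarrow> length I = length J"
  by (induction rule: slide.induct) auto

lemma move_mono: "move S I J \<Longrightarrow> S \<subseteq> T \<Longrightarrow> move T I J"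
  by (auto simp: move_def intro: packed_mono)

lemma reach_sym: "reach S I J \<Longrightarrow> reach S J I"
proof -
  have "symp (move S)" by (auto intro!: sympI simp: move_def intro: slide_sym)
  then show "reach S I J \<Longrightarrow> reach S J I" by (metis sympD symp_rtranclp)
qed

lemma reach_length: "reach S I J \<Longrightarrow> length I = length J"
  by (induction rule: rtranclp_induct) (auto simp: move_def dest: slide_length)

lemma reach_packed: "reach S I J \<Longrightarrow> packed S I \<Longrightarrow> packed S J"
  by (induction rule: rtranclp_induct) (auto simp: move_def)

lemma move_Cons_cases:
  assumes "move S (y # I) K"
  obtains (head) z where "K = z # I" "l y \<le> r z" "l z \<le> r y" "z \<in> S" "packed (after S z) I"
  | (tail) J where "K = y # J" "move (after S y) I J"
proof -
  from assms have "slide (y # I) K" "packed S (y # I)" "packed S K" by (auto simp: move_def)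
  then show thesis
    by (cases rule: slide.cases) (use head tail in \<open>auto simp: move_def\<close>)
qed

lemma reach_Cons: "reach (after S y) I J \<Longrightarrow> y \<in> S \<Longrightarrow> reach S (y # I) (y # J)"
proof (induction rule: rtranclp_induct)
  case (step J K)
  then have "move S (y # J) (y # K)" by (auto simp: move_def intro: slide_tail)
  with step show ?case by (meson rtranclp.rtrancl_into_rtrancl)
qed simp

definition touch :: "'a set \<Rightarrow> 'a \<Rightarrow> 'a \<Rightarrow> bool" where
  "touch W a b \<longleftrightarrow> a \<in> W \<and> b \<in> W \<and> l a \<le> r b \<and> l b \<le> r a"

text \<open>While the tail \<open>I\<close> stays fixed beyond all of \<open>W\<close>, the first
  token may walk through \<open>W\<close> as if it were alone.\<close>

lemma reach_head:
  assumes "(touch W)\<^sup>*\<^sup>* y z" "packed S (y # I)" "S \<subseteq> V" "\<And>w. w \<in> W \<Longrightarrow> w \<in> S \<and> before w I"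
  shows "reach S (y # I) (z # I)"
  using assms(1)
proof (induction rule: rtranclp_induct)
  case (step a b)
  have "packed S I" using assms(2) packed_mono[OF _ after_subset] by auto
  then have "packed S (a # I)" "packed S (b # I)"
    using step(2) assms(3,4) by (auto simp: touch_def intro: packed_after)
  then have "move S (a # I) (b # I)"
    using step(2) by (auto simp: move_def touch_def intro: slide_head)
  with step show ?case by simp
qed simp

text \<open>Pinning the first token as far left as it ever gets does not hinder the other tokens.\<close>

lemma reach_tl:
  assumes "reach S (y # I) K" "\<And>z J. reach S (y # I) (z # J) \<Longrightarrow> r x \<le> r z"
  shows "\<exists>z J. K = z # J \<and> reach (after S x) I J"
  using assms(1)
proof (induction rule: rtranclp_induct)
  case (step K L)
  then obtain z J where K: "K = z # J" "reach (after S x) I J" by blast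
  have "r x \<le> r z" using assms(2) step.hyps(1) K(1) by blast
  from step.hyps(2)[unfolded K(1)] show ?case
  proof (cases rule: move_Cons_cases)
    case (tail J')
    then have "move (after S x) J J'" using move_mono after_antimono[OF \<open>r x \<le> r z\<close>] by blast
    with K(2) have "reach (after S x) I J'" by (rule rtranclp.rtrancl_into_rtrancl)
    with tail show ?thesis by blast
  qed (use K in auto)
qed auto

section \<open>The room in front of a configuration and its minimum over components\<close>

definition room :: "'a list \<Rightarrow> nat" where
  "room I = (case I of [] \<Rightarrow> Suc (Max (r ` V)) | u # _ \<Rightarrow> l u)"

lemma r_le_Max: "v \<in> V \<Longrightarrow> r v \<le> Max (r ` V)"
  using finite_V by auto

lemma room_le:
  assumes "packed S I" "S \<subseteq> V"
  shows "room I \<le> Suc (Max (r ` V))"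
proof (cases I)
  case (Cons u I')
  then have "u \<in> V" using assms by auto
  then have "l u \<le> Max (r ` V)" using l_le_r r_le_Max le_trans by blast
  then show ?thesis using Cons by (simp add: room_def)
qed (simp add: room_def)

text \<open>The later tokens lie further right, so the left end of the first one decides. This makes
  \<open>before\<close> a comparison of numbers, for which maxima and minima are available.\<close>

lemma before_iff_room:
  assumes "packed S I" "S \<subseteq> V" "v \<in> V"
  shows "before v I \<longleftrightarrow> r v < room I"
proof (cases I)
  \<comment> \<open>The default value of \<open>room\<close> exceeds every right end, so every
    vertex lies before the empty configuration.\<close>
  case Nil
  then show ?thesis using r_le_Max[OF assms(3)] by (simp add: before_def room_def)
next
  case (Cons u I')
  have "u \<in> V" using assms Cons by auto
  have "r u < l w" if "w \<in> set I'" for w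
    using packed_before[of S u I'] assms Cons that by (auto simp: before_def)
  then show ?thesis using Cons l_le_r[OF \<open>u \<in> V\<close>] by (fastforce simp: before_def room_def)
qed

text \<open>\<open>far j S v\<close>: the minimum, over the components, of the room that \<open>j\<close> tokens on \<open>S\<close> can make
  to their left exceeds the right end of \<open>v\<close>; false if there is no configuration at all.\<close>

definition far :: "nat \<Rightarrow> 'a set \<Rightarrow> 'a \<Rightarrow> bool" where
  "far j S v \<longleftrightarrow> (\<exists>I. packed S I \<and> length I = j) \<and>
     (\<forall>I. packed S I \<and> length I = j \<longrightarrow> (\<exists>J. reach S I J \<and> before v J))"

text \<open>Within a component \<open>room\<close> is bounded, hence has a maximum
  \<open>best\<close>; \<open>J\<close> attains this maximum in a component where it is least. A
  single configuration thus describes \<open>far j S\<close> for all \<open>v\<close> at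
  once.\<close>

lemma far_minimax:
  assumes "packed S I0" "length I0 = j" "S \<subseteq> V"
  obtains J where "packed S J" "length J = j" "\<And>v. v \<in> V \<Longrightarrow> far j S v \<longleftrightarrow> before v J"
    "\<And>K. reach S J K \<Longrightarrow> room K \<le> room J"
    "\<And>I. packed S I \<Longrightarrow> length I = j \<Longrightarrow> \<exists>K. reach S I K \<and> room J \<le> room K"
proof -
  define best where "best I = Max (room ` {K. reach S I K})" for I
  have fin: "finite (room ` {K. reach S I K})" if "packed S I" for I
  proof (rule finite_subset)
    show "room ` {K. reach S I K} \<subseteq> {..Suc (Max (r ` V))}"
      using reach_packed[OF _ that] room_le[OF _ assms(3)] by blast
  qed simp
  have best_ge: "room K \<le> best I" if "packed S I" "reach S I K" for I K
    unfolding best_def by (rule Max_ge) (use fin that in auto)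
  have best_ex: "\<exists>K. reach S I K \<and> room K = best I" if "packed S I" for I
  proof -
    have "best I \<in> room ` {K. reach S I K}"
      unfolding best_def by (rule Max_in) (use fin that in auto)
    then show ?thesis by force
  qed
  obtain I where I: "packed S I" "length I = j"
    and least: "\<And>I'. packed S I' \<Longrightarrow> length I' = j \<Longrightarrow> best I \<le> best I'"
    using ex_has_least_nat[of "\<lambda>I. packed S I \<and> length I = j" I0 best] assms by blast
  obtain J where J: "reach S I J" "room J = best I" using best_ex I(1) by blast
  have pJ: "packed S J" and lJ: "length J = j" using reach_packed reach_length J(1) I by auto
  have up: "\<exists>K. reach S I' K \<and> room J \<le> room K" if "packed S I'" "length I' = j" for I'
    using best_ex[OF that(1)] least[OF that] J(2) by auto
  have "far j S v \<longleftrightarrow> before v J" if v: "v \<in> V" for v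
  proof
    assume "far j S v"
    then obtain K where "reach S I K" "before v K" using I by (auto simp: far_def)
    then have "r v < room K" using before_iff_room reach_packed I(1) assms(3) v by blast
    also have "room K \<le> room J" using best_ge I(1) \<open>reach S I K\<close> J(2) by simp
    finally show "before v J" using before_iff_room pJ assms(3) v by blast
  next
    assume "before v J"
    then have *: "r v < room J" using before_iff_room pJ assms(3) v by blast
    have "\<exists>K. reach S I' K \<and> before v K" if I': "packed S I'" "length I' = j" for I'
    proof -
      obtain K where "reach S I' K" "room J \<le> room K" using up[OF I'] by blast
      moreover from this have "before v K"
        using * before_iff_room[of S K v] reach_packed I'(1) assms(3) v by fastforce
      ultimately show ?thesis by blast
    qed
    then show "far j S v" using assms by (auto simp: far_def)
  qed
  moreover have "room K \<le> room J" if "reach S J K" for K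
    using best_ge[OF I(1)] rtranclp_trans[OF J(1) that] J(2) by simp
  ultimately show thesis using that[OF pJ lJ _ _ up] by blast
qed

section \<open>Leftmost positions of the first token, and the recursions they give\<close>

text \<open>The places open to the first token when the others, kept behind \<open>y\<close>, are in
  their worst component and have given way as far as possible there.\<close>

definition win :: "nat \<Rightarrow> 'a set \<Rightarrow> 'a \<Rightarrow> 'a set" where
  "win j S y = {v \<in> S. far j (after S y) v}"

text \<open>\<open>cand j S y\<close>: in some component of \<open>j + 1\<close> tokens on \<open>S\<close>, the leftmost position of the first
  token is \<open>y\<close>. A detour to the left of \<open>y\<close> can be shortened to two slides, via \<open>u\<close> to \<open>w\<close>.\<close>

definition cand :: "nat \<Rightarrow> 'a set \<Rightarrow> 'a \<Rightarrow> bool" where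
  "cand j S y \<longleftrightarrow> y \<in> win j S y \<and>
     (\<forall>u \<in> win j S y. \<forall>w \<in> win j S y. \<not> (l u \<le> r w \<and> r w < r y \<and> r y \<le> r u))"

text \<open>The positions that the first token reaches from \<open>y\<close>: there is no gap between \<open>y\<close> and \<open>u\<close>
  left uncovered by the intervals available to it.\<close>

definition swept :: "nat \<Rightarrow> 'a set \<Rightarrow> 'a \<Rightarrow> 'a \<Rightarrow> bool" where
  "swept j S y u \<longleftrightarrow> u \<in> win j S y \<and> r y \<le> r u \<and>
     (\<forall>w \<in> win j S y. r y \<le> r w \<and> r w < l u \<longrightarrow> (\<exists>z \<in> win j S y. l z \<le> r w \<and> r w < r z))"

lemma win_self_iff:
  "y \<in> S \<Longrightarrow> y \<in> win j S y \<longleftrightarrow> (\<exists>I. packed (after S y) I \<and> length I = j)"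
  using packed_before by (auto simp: win_def far_def)

text \<open>A chain leaving the region right of \<open>r y\<close> has a step from some
  \<open>a\<close> with \<open>r y \<le> r a\<close> to some \<open>b\<close> with
  \<open>r b < r y\<close>. Touching gives \<open>l a \<le> r b\<close>, so \<open>u = a\<close> and
  \<open>w = b\<close> violate \<open>cand\<close>. Such an \<open>a\<close> also touches
  \<open>y\<close>, which is why two slides cover every detour.\<close>

lemma cand_chain_ge:
  assumes "cand j S y" "(touch (win j S y))\<^sup>*\<^sup>* y u"
  shows "r y \<le> r u \<and> u \<in> win j S y"
  using assms(2)
proof (induction rule: rtranclp_induct)
  case base
  then show ?case using assms(1) by (auto simp: cand_def)
next
  case (step a b)
  then show ?case using assms(1) by (fastforce simp: cand_def touch_def)
qed

text \<open>The step that first carries the right end beyond \<open>p\<close> leads to an interval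
  that still meets one ending at or before \<open>p\<close>.\<close>

lemma chain_crosses:
  assumes "(touch W)\<^sup>*\<^sup>* y u" "r y \<le> p" "p < r u"
  shows "\<exists>z \<in> W. l z \<le> p \<and> p < r z"
  using assms(1,3)
proof (induction rule: rtranclp_induct)
  case (step a b)
  then show ?case by (cases "p < r a") (auto simp: touch_def intro!: bexI[of _ b])
qed (use assms(2) in simp)

text \<open>The first interval of the chain whose right end reaches \<open>l u\<close> touches
  \<open>u\<close>: it is \<open>y\<close> itself, or it begins no later than the end of its
  predecessor, which lies before \<open>l u\<close>.\<close>

lemma chain_meets:
  assumes "(touch W)\<^sup>*\<^sup>* y w" "y \<in> W" "u \<in> W" "W \<subseteq> V" "r y \<le> r u" "l u \<le> r w"
  shows "(touch W)\<^sup>*\<^sup>* y u"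
  using assms(1,6)
proof (induction rule: rtranclp_induct)
  case base
  have "l y \<le> r y" using assms l_le_r by blast
  then have "touch W y u" using base assms by (auto simp: touch_def)
  then show ?case by blast
next
  case (step a b)
  show ?case
  proof (cases "l u \<le> r a")
    case False
    have "l u \<le> r u" using assms l_le_r by blast
    then have "touch W b u" using False step.prems step.hyps(2) assms by (auto simp: touch_def)
    with step.hyps show ?thesis by (meson rtranclp.rtrancl_into_rtrancl)
  qed (use step in blast)
qed

text \<open>A walk among intervals can be stopped only by a gap in their union, and a gap can be
  detected at right ends \<open>r w\<close>. This replaces a transitive closure by a first-order
  condition, as the compiled rounds require.\<close>

lemma swept_iff_chain:
  assumes "cand j S y" "S \<subseteq> V"
  shows "swept j S y u \<longleftrightarrow> (touch (win j S y))\<^sup>*\<^sup>* y u"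
proof
  let ?W = "win j S y"
  have WV: "?W \<subseteq> V" using assms(2) by (auto simp: win_def)
  have yW: "y \<in> ?W" using assms(1) by (simp add: cand_def)
  show "swept j S y u" if "(touch ?W)\<^sup>*\<^sup>* y u"
  proof -
    have "u \<in> ?W" "r y \<le> r u" using cand_chain_ge[OF assms(1) that] by auto
    moreover from this have "l u \<le> r u" using WV l_le_r by blast
    ultimately show ?thesis
      using chain_crosses[OF that] unfolding swept_def by (meson less_le_trans)
  qed
  show "(touch ?W)\<^sup>*\<^sup>* y u" if sw: "swept j S y u"
  proof -
    let ?C = "{w. (touch ?W)\<^sup>*\<^sup>* y w}"
    have C: "?C \<subseteq> ?W" using cand_chain_ge[OF assms(1)] by auto
    then have "finite ?C" using WV finite_V finite_subset by meson
    then have fin: "finite (r ` ?C)" by simp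
    have "Max (r ` ?C) \<in> r ` ?C" using fin by (rule Max_in) auto
    \<comment> \<open>\<open>w\<close> has the largest right end reached. If \<open>u\<close> began
      beyond it, the no-gap condition at \<open>r w\<close> would supply a reachable
      \<open>z\<close> ending later.\<close>
    then obtain w where w: "w \<in> ?C" "r w = Max (r ` ?C)" by force
    then have mx: "r z \<le> r w" if "z \<in> ?C" for z using that fin by simp
    have "l u \<le> r w"
    proof (rule ccontr)
      assume "\<not> l u \<le> r w"
      moreover have "w \<in> ?W" "r y \<le> r w" using w(1) C mx[of y] by auto
      ultimately have "\<exists>z \<in> ?W. l z \<le> r w \<and> r w < r z"
        using sw unfolding swept_def by (meson not_le)
      then obtain z where z: "z \<in> ?W" "l z \<le> r w" "r w < r z" by blast
      have "l w \<le> r w" using w C WV l_le_r by blast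
      then have "touch ?W w z" using z w C by (auto simp: touch_def)
      then have "z \<in> ?C" using w(1) by (simp add: rtranclp.rtrancl_into_rtrancl)
      then show False using mx z(3) by fastforce
    qed
    then show ?thesis using chain_meets[of ?W y w u] w(1) yW WV sw by (auto simp: swept_def)
  qed
qed

text \<open>An invariant of all walks from \<open>y # J\<close>. A new head must clear the current
  tail \<open>K\<close>, whose room is at most that of \<open>J\<close>, so it lies in
  \<open>win j S y\<close>; by \<open>cand\<close> the head never gets left of \<open>y\<close>, so
  a step of the tail remains a move on \<open>after S y\<close>.\<close>

lemma cand_reach:
  assumes cand: "cand j S y" and S: "S \<subseteq> V"
    and J: "packed (after S y) J" "length J = j"
      "\<And>v. v \<in> V \<Longrightarrow> far j (after S y) v \<longleftrightarrow> before v J"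
      "\<And>K. reach (after S y) J K \<Longrightarrow> room K \<le> room J"
    and reach: "reach S (y # J) L"
  shows "\<exists>z K. L = z # K \<and> swept j S y z \<and> reach (after S y) J K"
  using reach
proof (induction rule: rtranclp_induct)
  case base
  then show ?case using swept_iff_chain[OF cand S] by simp
next
  case (step M L)
  then obtain z K where M: "M = z # K" "(touch (win j S y))\<^sup>*\<^sup>* y z" "reach (after S y) J K"
    using swept_iff_chain[OF cand S] by blast
  note z = cand_chain_ge[OF cand M(2)]
  from step.hyps(2)[unfolded M(1)] show ?case
  proof (cases rule: move_Cons_cases)
    case (head z')
    have "z' \<in> V" using head S by auto
    have "after S y \<subseteq> V" using S after_subset by blast
    have "r z' < room K"
      using before_iff_room[OF reach_packed[OF M(3) J(1)] \<open>after S y \<subseteq> V\<close> \<open>z' \<in> V\<close>]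
        packed_before[OF head(5)] by simp
    then have "r z' < room J" using J(4)[OF M(3)] by simp
    then have "far j (after S y) z'"
      using before_iff_room[OF J(1) \<open>after S y \<subseteq> V\<close> \<open>z' \<in> V\<close>] J(3) \<open>z' \<in> V\<close> by simp
    then have "touch (win j S y) z z'" using head z by (simp add: touch_def win_def)
    then have "swept j S y z'"
      using M(2) swept_iff_chain[OF cand S] by (meson rtranclp.rtrancl_into_rtrancl)
    with head M show ?thesis by blast
  next
    case (tail K')
    then have "move (after S y) K K'" using move_mono after_antimono z by blast
    with M(3) have "reach (after S y) J K'" by (rule rtranclp.rtrancl_into_rtrancl)
    with tail M(2) show ?thesis using swept_iff_chain[OF cand S] by blast
  qed
qed

text \<open>Every component contains a configuration whose first token is as far left as possible;
  its position is a candidate, because the remaining tokens can give way at least as far as in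
  the worst component.\<close>

lemma reach_cand:
  assumes S: "S \<subseteq> V" and I: "packed S I" "length I = Suc j"
  obtains y J where "reach S I (y # J)" "cand j S y"
    "\<And>v. v \<in> win j S y \<Longrightarrow> before v J" "packed S (y # J)" "length J = j"
proof -
  define P where "P z = (\<exists>K. reach S I (z # K))" for z
  obtain z0 K0 where "I = z0 # K0" using I(2) by (cases I) auto
  then have "P z0" unfolding P_def by blast
  then obtain y where "P y" and least: "\<And>z. P z \<Longrightarrow> r y \<le> r z"
    using ex_has_least_nat[of P z0 r] by blast
  then obtain K where K: "reach S I (y # K)" unfolding P_def by blast
  have yK: "y \<in> S" "packed (after S y) K" "length K = j"
    using reach_packed[OF K I(1)] reach_length[OF K] I(2) by auto
  have AV: "after S y \<subseteq> V" using S after_subset by blast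
  obtain J0 where J0: "packed (after S y) J0"
      "\<And>v. v \<in> V \<Longrightarrow> far j (after S y) v \<longleftrightarrow> before v J0"
      "\<And>I. packed (after S y) I \<Longrightarrow> length I = j \<Longrightarrow> \<exists>K. reach (after S y) I K \<and> room J0 \<le> room K"
    using far_minimax[OF yK(2,3) AV] by metis
  obtain J where J: "reach (after S y) K J" "room J0 \<le> room J" using J0(3) yK by blast
  have pJ: "packed (after S y) J" using reach_packed J(1) yK by blast
  have win: "before v J" if "v \<in> win j S y" for v
  proof -
    have "v \<in> V" "before v J0" using that S J0(2) by (auto simp: win_def)
    then have "r v < room J" using before_iff_room[OF J0(1) AV] J(2) by fastforce
    then show ?thesis using before_iff_room[OF pJ AV \<open>v \<in> V\<close>] by simp
  qed
  have rJ: "reach S I (y # J)" using K reach_Cons[OF J(1) yK(1)] by simp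
  have yw: "y \<in> win j S y" using win_self_iff yK by blast
  have "cand j S y" unfolding cand_def
  proof (intro conjI yw ballI notI)
    fix u w assume uw: "u \<in> win j S y" "w \<in> win j S y" "l u \<le> r w \<and> r w < r y \<and> r y \<le> r u"
    have "l y \<le> r y" "l w \<le> r w" using yK uw S l_le_r by (auto simp: win_def)
    then have "touch (win j S y) y u" "touch (win j S y) u w" using uw yw by (auto simp: touch_def)
    then have "(touch (win j S y))\<^sup>*\<^sup>* y w" by (meson rtranclp.rtrancl_into_rtrancl r_into_rtranclp)
    then have "reach S (y # J) (w # J)"
      by (rule reach_head) (use yK pJ S win in \<open>auto simp: win_def\<close>)
    then have "P w" using rJ unfolding P_def by (meson rtranclp_trans)
    then show False using least uw by fastforce
  qed
  moreover have "length J = j" using reach_length J(1) yK by force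
  ultimately show thesis using that rJ win yK(1) pJ by simp
qed

text \<open>Replacing the first token of any configuration by the vertex of smallest right end keeps
  it packed, and no position lies further left.\<close>

lemma leftmost_cand:
  assumes S: "S \<subseteq> V" and I: "packed S I" "length I = Suc j"
  obtains y where "cand j S y" "\<And>v. v \<in> S \<Longrightarrow> r y \<le> r v"
proof -
  obtain z K where zK: "I = z # K" using I by (cases I) auto
  then have "z \<in> S" using I by simp
  then obtain y where y: "y \<in> S" "\<And>v. v \<in> S \<Longrightarrow> r y \<le> r v"
    using ex_has_least_nat[of "\<lambda>v. v \<in> S" z r] by blast
  then have "packed (after S y) K"
    using I zK packed_mono[OF _ after_antimono[OF y(2)]] by auto
  then have "y \<in> win j S y" using win_self_iff y I zK by auto
  then have "cand j S y" using y(2) by (fastforce simp: cand_def win_def)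
  with y that show thesis by blast
qed

text \<open>The converse of \<open>reach_cand\<close>: put behind \<open>y\<close> a tail from the
  worst component that has already given way completely. The first token is then confined to
  \<open>swept\<close>, hence never gets left of \<open>y\<close>.\<close>

lemma cand_minimax:
  assumes S: "S \<subseteq> V" and cand: "cand j S y"
  obtains J where "packed S (y # J)" "length J = j"
    "\<And>z K. reach S (y # J) (z # K) \<Longrightarrow> swept j S y z"
proof -
  have y: "y \<in> S" "y \<in> win j S y" using cand by (auto simp: cand_def win_def)
  then obtain I0 where I0: "packed (after S y) I0" "length I0 = j" using win_self_iff by blast
  have AV: "after S y \<subseteq> V" using S after_subset by blast
  obtain J where J: "packed (after S y) J" "length J = j"
      "\<And>v. v \<in> V \<Longrightarrow> far j (after S y) v \<longleftrightarrow> before v J"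
      "\<And>K. reach (after S y) J K \<Longrightarrow> room K \<le> room J"
    using far_minimax[OF I0 AV] by metis
  have "swept j S y z" if "reach S (y # J) (z # K)" for z K
    using cand_reach[OF cand S J that] by auto
  then show thesis using that J y by auto
qed

text \<open>For one direction each candidate is tested on its worst configuration, from which the
  first token visits only swept places. For the other, every component contains a configuration
  headed by a candidate whose tail leaves all of \<open>win\<close> free, so the first token can
  walk to \<open>u\<close>; the tail lies behind \<open>u\<close>, so \<open>r v < l u\<close>
  suffices.\<close>

lemma far_Suc:
  assumes S: "S \<subseteq> V"
  shows "far (Suc j) S v \<longleftrightarrow>
    (\<exists>y. cand j S y) \<and> (\<forall>y. cand j S y \<longrightarrow> (\<exists>u. swept j S y u \<and> r v < l u))"
proof (intro iffI conjI allI impI)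
  assume far: "far (Suc j) S v"
  then obtain I where I: "packed S I" "length I = Suc j" by (auto simp: far_def)
  show "\<exists>y. cand j S y" using leftmost_cand[OF S I] by metis
  fix y assume cand: "cand j S y"
  obtain J where J: "packed S (y # J)" "length J = j"
    "\<And>z K. reach S (y # J) (z # K) \<Longrightarrow> swept j S y z"
    using cand_minimax[OF S cand] by metis
  then have "packed S (y # J)" "length (y # J) = Suc j" by auto
  then obtain L where L: "reach S (y # J) L" "before v L"
    using far unfolding far_def by blast
  then obtain z K where zK: "L = z # K" using reach_length[OF L(1)] by (cases L) auto
  then show "\<exists>u. swept j S y u \<and> r v < l u" using J(3) L by (auto simp: before_def)
next
  assume R: "(\<exists>y. cand j S y) \<and> (\<forall>y. cand j S y \<longrightarrow> (\<exists>u. swept j S y u \<and> r v < l u))"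
  then obtain y where "cand j S y" by blast
  then have "\<exists>I. packed S I \<and> length I = Suc j"
    using cand_minimax[OF S] by (metis length_Cons)
  moreover have "\<exists>K. reach S I K \<and> before v K" if I: "packed S I" "length I = Suc j" for I
  proof -
    obtain y J where J: "reach S I (y # J)" "cand j S y"
      "\<And>v. v \<in> win j S y \<Longrightarrow> before v J" "packed S (y # J)"
      using reach_cand[OF S I] by metis
    obtain u where u: "swept j S y u" "r v < l u" using R J(2) by blast
    have "(touch (win j S y))\<^sup>*\<^sup>* y u" using swept_iff_chain[OF J(2) S] u(1) by simp
    then have "reach S (y # J) (u # J)"
      by (rule reach_head) (use J S in \<open>auto simp: win_def\<close>)
    moreover have "before v (u # J)"
    proof -
      have uw: "u \<in> win j S y" using u by (simp add: swept_def)
      then have "l u \<le> r u" "before u J" using l_le_r S J(3) by (auto simp: win_def)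
      then show ?thesis using u(2) by (fastforce simp: before_def)
    qed
    ultimately show ?thesis using J(1) by (meson rtranclp_trans)
  qed
  ultimately show "far (Suc j) S v" by (auto simp: far_def)
qed

definition joined :: "nat \<Rightarrow> 'a set \<Rightarrow> bool" where
  "joined j S \<longleftrightarrow> (\<exists>I. packed S I \<and> length I = j) \<and>
     (\<forall>I J. packed S I \<and> length I = j \<and> packed S J \<and> length J = j \<longrightarrow> reach S I J)"

text \<open>Components are told apart by the leftmost position of the first token or, if that
  agrees, by the tail. Right ends are compared instead of vertices: vertices of equal right end have
  the same \<open>after\<close> and touch, so the first token can switch between them.\<close>

lemma joined_Suc:
  assumes S: "S \<subseteq> V"
  shows "joined (Suc j) S \<longleftrightarrow>
    (\<exists>y. cand j S y \<and> joined j (after S y) \<and> (\<forall>y'. cand j S y' \<longrightarrow> r y = r y'))"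
proof
  assume jn: "joined (Suc j) S"
  then obtain I where I: "packed S I" "length I = Suc j" by (auto simp: joined_def)
  \<comment> \<open>With \<open>y\<close> leftmost in all of \<open>S\<close>, no first token is
    ever left of it, so \<open>reach_tl\<close> projects walks onto
    \<open>after S y\<close>.\<close>
  obtain y where y: "cand j S y" "\<And>v. v \<in> S \<Longrightarrow> r y \<le> r v" using leftmost_cand[OF S I] by metis
  have yS: "y \<in> S" and "\<exists>I. packed (after S y) I \<and> length I = j"
    using y(1) win_self_iff by (auto simp: cand_def win_def)
  moreover have "reach (after S y) K L"
    if "packed (after S y) K" "length K = j" "packed (after S y) L" "length L = j" for K L
  proof -
    have r: "reach S (y # K) (y # L)" using jn that yS by (simp add: joined_def)
    have "r y \<le> r z" if "reach S (y # K) (z # J)" for z J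
      using reach_packed[OF that] yS \<open>packed (after S y) K\<close> y(2) by simp
    then show ?thesis using reach_tl[OF r] by blast
  qed
  ultimately have "joined j (after S y)" by (simp add: joined_def)
  moreover have "r y = r y'" if c: "cand j S y'" for y'
  proof -
    obtain J where J: "packed S (y' # J)" "length J = j"
      "\<And>z K. reach S (y' # J) (z # K) \<Longrightarrow> swept j S y' z"
      using cand_minimax[OF S c] by metis
    obtain J' where J': "packed S (y # J')" "length J' = j"
      using cand_minimax[OF S y(1)] by metis
    \<comment> \<open>From \<open>y' # J\<close> only swept places are visited, and these have right
      end at least \<open>r y'\<close>.\<close>
    have "reach S (y' # J) (y # J')" using J J' jn by (simp add: joined_def)
    then have "r y' \<le> r y" using J(3) by (auto simp: swept_def)
    then show ?thesis using y(2) J(1) by fastforce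
  qed
  ultimately show "\<exists>y. cand j S y \<and> joined j (after S y) \<and> (\<forall>y'. cand j S y' \<longrightarrow> r y = r y')"
    using y by blast
next
  assume "\<exists>y. cand j S y \<and> joined j (after S y) \<and> (\<forall>y'. cand j S y' \<longrightarrow> r y = r y')"
  then obtain y where y: "cand j S y" "joined j (after S y)" "\<And>y'. cand j S y' \<Longrightarrow> r y = r y'"
    by blast
  then have yS: "y \<in> S" by (simp add: cand_def win_def)
  have to_y: "\<exists>J. reach S I (y # J) \<and> packed (after S y) J \<and> length J = j"
    if I: "packed S I" "length I = Suc j" for I
  proof -
    obtain z J where J: "reach S I (z # J)" "cand j S z" "packed S (z # J)" "length J = j"
      using reach_cand[OF S I] by metis
    have "r y = r z" using y(3) J(2) .
    then have "after S y = after S z" by (simp add: after_def)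
    moreover have "l y \<le> r y" "l z \<le> r z" using yS J(3) S l_le_r by auto
    ultimately have "move S (z # J) (y # J)"
      using J(3) yS \<open>r y = r z\<close> by (auto simp: move_def intro: slide_head)
    then show ?thesis
      using J \<open>after S y = after S z\<close> by (auto intro: rtranclp.rtrancl_into_rtrancl)
  qed
  have "\<exists>I. packed S I \<and> length I = Suc j" using cand_minimax[OF S y(1)] by (metis length_Cons)
  moreover have "reach S I K" if I: "packed S I" "length I = Suc j" and K: "packed S K" "length K = Suc j" for I K
  proof -
    obtain J where J: "reach S I (y # J)" "packed (after S y) J" "length J = j" using to_y I by blast
    obtain L where L: "reach S K (y # L)" "packed (after S y) L" "length L = j" using to_y K by blast
    have "reach (after S y) J L" using y(2) J L by (simp add: joined_def)
    then have "reach S (y # J) (y # L)" using reach_Cons yS by blast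
    then show ?thesis using J(1) reach_sym[OF L(1)] by (meson rtranclp_trans)
  qed
  ultimately show "joined (Suc j) S" by (simp add: joined_def)
qed

section \<open>Sorted lists versus independent sets\<close>

lemma packed_distinct:
  assumes "packed S I" "S \<subseteq> V" shows "distinct I"
  using assms
proof (induction I arbitrary: S)
  case (Cons y I)
  then have "y \<notin> after S y" using l_le_r[of y] by (auto simp: after_def)
  then have "y \<notin> set I" using packed_subset Cons.prems by auto
  then show ?case using Cons after_subset by fastforce
qed simp

lemma packed_separated:
  assumes "packed S I" "S \<subseteq> V" "u \<in> set I" "v \<in> set I" "u \<noteq> v"
  shows "r u < l v \<or> r v < l u"
  using assms
proof (induction I arbitrary: S)
  case (Cons y I)
  then have "before y I" using packed_before by auto
  moreover have "after S y \<subseteq> V" using Cons.prems(2) after_subset by blast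
  ultimately show ?case using Cons by (auto simp: before_def)
qed simp

text \<open>Disjointness puts every other member behind the one with the smallest right end, which
  becomes the head.\<close>

lemma packed_exists:
  assumes "finite T" "T \<subseteq> S" "S \<subseteq> V" "\<And>u v. u \<in> T \<Longrightarrow> v \<in> T \<Longrightarrow> u \<noteq> v \<Longrightarrow> r u < l v \<or> r v < l u"
  shows "\<exists>I. packed S I \<and> set I = T"
  using assms
proof (induction "card T" arbitrary: T S)
  case 0
  then have "packed S [] \<and> set [] = T" by simp
  then show ?case by blast
next
  case (Suc c)
  then obtain z where "z \<in> T" by fastforce
  then obtain y where y: "y \<in> T" "\<And>v. v \<in> T \<Longrightarrow> r y \<le> r v"
    using ex_has_least_nat[of "\<lambda>v. v \<in> T" z r] by blast
  have "r y < l v" if "v \<in> T - {y}" for v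
  proof -
    have "r y < l v \<or> r v < l y" using Suc.prems(4)[of y v] y(1) that by auto
    moreover have "l y \<le> r y" "r y \<le> r v" using l_le_r y Suc.prems(2,3) that by auto
    ultimately show ?thesis by linarith
  qed
  then have "T - {y} \<subseteq> after S y" using Suc.prems(2) by (auto simp: after_def)
  moreover have "c = card (T - {y})" using Suc.hyps(2) Suc.prems(1) y(1) by simp
  moreover have "after S y \<subseteq> V" using Suc.prems(3) after_subset by blast
  ultimately have "\<exists>I. packed (after S y) I \<and> set I = T - {y}"
    by (intro Suc.hyps(1)) (use Suc.prems(1,4) in auto)
  then obtain I where "packed (after S y) I" "set I = T - {y}" by blast
  then have "packed S (y # I) \<and> set (y # I) = T" using y Suc.prems(2) by auto
  then show ?case by blast
qed

lemma packed_unique: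
  assumes "packed S I" "packed S J" "S \<subseteq> V" "set I = set J" shows "I = J"
  using assms
proof (induction I arbitrary: S J)
  case (Cons a I)
  then obtain b J' where J: "J = b # J'" by (cases J) auto
  have bf: "before a I" "before b J'" using Cons.prems J packed_before by auto
  have V: "a \<in> V" "b \<in> V" using Cons.prems J by auto
  have "a = b"
  proof (rule ccontr)
    assume "a \<noteq> b"
    then have "r b < l a" "r a < l b" using Cons.prems(4) J bf by (auto simp: before_def)
    then show False using l_le_r[OF V(1)] l_le_r[OF V(2)] by simp
  qed
  moreover have "set I = set J'"
    using packed_distinct[OF Cons.prems(1,3)] packed_distinct[OF Cons.prems(2,3)] Cons.prems(4) J \<open>a = b\<close>
    by auto
  moreover have "after S a \<subseteq> V" using Cons.prems after_subset by blast
  ultimately show ?case using Cons.IH[of "after S a" J'] Cons.prems J by auto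
qed auto

lemma slide_set_diff:
  assumes "slide I J" "packed S I" "packed S J" "S \<subseteq> V"
  shows "I = J \<or> (\<exists>u v. set I - set J = {v} \<and> set J - set I = {u} \<and> u \<noteq> v \<and>
    u \<in> V \<and> v \<in> V \<and> l u \<le> r v \<and> l v \<le> r u)"
  using assms
proof (induction arbitrary: S rule: slide.induct)
  case (slide_head y z I)
  show ?case
  proof (cases "y = z")
    case False
    have "y \<notin> set I" "z \<notin> set I"
      using packed_distinct slide_head.prems by (metis distinct.simps(2))+
    then have "set (y # I) - set (z # I) = {y}" "set (z # I) - set (y # I) = {z}" using False by auto
    moreover have "y \<in> V" "z \<in> V" using slide_head.prems by auto
    ultimately show ?thesis using False slide_head.hyps by blast
  qed simp
next
  case (slide_tail I J y)
  have V: "after S y \<subseteq> V" using slide_tail.prems after_subset by blast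
  have "y \<notin> set I" "y \<notin> set J"
    using packed_distinct slide_tail.prems by (metis distinct.simps(2))+
  then have "set (y # I) - set (y # J) = set I - set J" "set (y # J) - set (y # I) = set J - set I"
    by auto
  then show ?case using slide_tail.IH[OF _ _ V] slide_tail.prems by simp
qed

text \<open>An exchange of adjacent vertices cannot change the rank of a token. If the heads
  \<open>a\<close> and \<open>b\<close> differ, neither survives in the other list: were
  \<open>a\<close> in \<open>J\<close>, then \<open>b = u\<close> would end before \<open>a\<close>
  and \<open>v\<close> would begin after it, so \<open>u\<close> and \<open>v\<close> could not
  meet. The heads are therefore \<open>v\<close> and \<open>u\<close>, and the tails agree.\<close>

lemma slide_if_set_diff:
  assumes "packed S I" "packed S J" "S \<subseteq> V" "set I - set J = {v}" "set J - set I = {u}"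
    "l u \<le> r v" "l v \<le> r u"
  shows "slide I J"
  using assms
proof (induction I arbitrary: S J)
  case (Cons a I)
  then obtain b J' where J: "J = b # J'" by (cases J) auto
  have bf: "before a I" "before b J'" using Cons.prems J packed_before by auto
  have ab: "a \<in> V" "b \<in> V" using Cons.prems J by auto
  have le: "l a \<le> r a" "l b \<le> r b" using ab l_le_r by auto
  have nin: "a \<notin> set I" "b \<notin> set J'"
    using packed_distinct Cons.prems J by (metis distinct.simps(2))+
  have V: "after S a \<subseteq> V" using Cons.prems after_subset by blast
  show ?case
  proof (cases "a = b")
    case True
    have "set I - set J' = {v}" "set J' - set I = {u}" using Cons.prems J nin True by auto
    then have "slide I J'" using Cons.IH[of "after S a" J'] Cons.prems J True V by simp
    then show ?thesis using J True slide.slide_tail by blast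
  next
    case False
    have "a \<notin> set J"
    proof
      assume aJ: "a \<in> set J"
      then have "r b < l a" using False J bf by (auto simp: before_def)
      then have "b \<notin> set I" using bf(1) le by (fastforce simp: before_def)
      then have "b = u" using Cons.prems(5) J False by auto
      have "v \<in> set I" using Cons.prems(4) aJ by auto
      then have "r a < l v" using bf by (auto simp: before_def)
      then show False using \<open>r b < l a\<close> \<open>b = u\<close> le Cons.prems(7) by simp
    qed
    then have av: "a = v" using Cons.prems(4) by auto
    have "b \<notin> set (a # I)"
    proof
      assume "b \<in> set (a # I)"
      then have "r a < l b" using False bf by (auto simp: before_def)
      have "u \<in> set J'" using Cons.prems(5) J \<open>b \<in> set (a # I)\<close> by auto
      then have "r b < l u" using bf by (auto simp: before_def)
      then show False using \<open>r a < l b\<close> av le Cons.prems(6) by simp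
    qed
    then have bu: "b = u" using Cons.prems(5) J by auto
    have "set (a # I) - {v} = set J - {u}" using Cons.prems(4,5) by blast
    then have sets: "set I = set J'" using J av bu nin by simp
    have "packed S I" "packed S J'"
      using Cons.prems J packed_mono[OF _ after_subset] by auto
    then have "I = J'" using packed_unique sets Cons.prems(3) by blast
    then show ?thesis using J av bu Cons.prems slide.slide_head by blast
  qed
qed simp

lemma joined_iff_TS_connected:
  assumes V: "pverts G = V"
    and arcs: "\<And>u v. (u, v) \<in> parcs G \<longleftrightarrow> u \<in> V \<and> v \<in> V \<and> u \<noteq> v \<and> l u \<le> r v \<and> l v \<le> r u"
  shows "joined k V \<longleftrightarrow> Digraph_Component.connected (with_proj (TS_graph k G))"
proof -
  let ?T = "TS_graph k G"
  let ?F = "{S. k_independent_set G k S}"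
  have indep: "k_independent_set G k (set I)" if "packed V I" "length I = k" for I
    unfolding k_independent_set_def
    using that packed_subset[OF that(1)] packed_separated[OF that(1)] packed_distinct[OF that(1)] V
    by (auto simp: arcs distinct_card) (metis leD)
  have ex: "\<exists>I. packed V I \<and> length I = k \<and> set I = S" if S: "k_independent_set G k S" for S
  proof -
    have S': "finite S" "S \<subseteq> V" "card S = k" using S V by (auto simp: k_independent_set_def)
    have "r u < l v \<or> r v < l u" if "u \<in> S" "v \<in> S" "u \<noteq> v" for u v
      using S that S' unfolding k_independent_set_def arcs by (meson not_le subsetD)
    then obtain I where "packed V I" "set I = S" using packed_exists[OF S'(1,2)] by blast
    moreover from this have "length I = k" using packed_distinct S'(3) distinct_card by fastforce
    ultimately show ?thesis by blast
  qed
  have sym: "(T, S) \<in> parcs ?T" if "(S, T) \<in> parcs ?T" for S T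
    using that unfolding TS_graph_def arcs by auto
  \<comment> \<open>The arcs are symmetric already, so the symmetric closure inside
    \<open>connected\<close> adds nothing.\<close>
  then have "(\<Union>e \<in> parcs ?T. {(fst e, snd e), (snd e, fst e)}) = parcs ?T" by auto
  then have conn: "Digraph_Component.connected (with_proj ?T) \<longleftrightarrow>
    ?F \<noteq> {} \<and> (\<forall>S \<in> ?F. \<forall>T \<in> ?F. (S, T) \<in> rtrancl_on ?F (parcs ?T))"
    unfolding Digraph_Component.connected_def strongly_connected_def reachable_def mk_symmetric_def
    by (simp add: TS_graph_def)
  have fwd: "(set I, set J) \<in> rtrancl_on ?F (parcs ?T)" if "reach V I J" "packed V I" "length I = k" for I J
    using that(1)
  proof (induction rule: rtranclp_induct)
    case base
    then show ?case using indep that by auto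
  next
    case (step J K)
    then have JK: "packed V J" "packed V K" "slide J K" by (auto simp: move_def)
    moreover have len: "length J = k" "length K = k"
      using reach_length[OF step(1)] slide_length[OF JK(3)] that by auto
    ultimately have "J = K \<or> (set J, set K) \<in> parcs ?T"
      using slide_set_diff[OF JK(3,1,2)] indep unfolding TS_graph_def arcs by fastforce
    then show ?case
      using step.IH indep JK(2) len(2) by (auto intro: rtrancl_on_into_rtrancl_on)
  qed
  have bwd: "\<exists>J. reach V I J \<and> set J = T" if "(set I, T) \<in> rtrancl_on ?F (parcs ?T)" "packed V I" for I T
    using that(1)
  proof (induction rule: rtrancl_on_induct)
    case base
    then show ?case by blast
  next
    case (step S T)
    then obtain J where J: "reach V I J" "set J = S" by blast
    have pJ: "packed V J" using reach_packed J that by blast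
    from step(2) obtain u v where uv: "S - T = {v}" "T - S = {u}" "(u, v) \<in> parcs G"
      "k_independent_set G k T" by (auto simp: TS_graph_def)
    obtain K where K: "packed V K" "set K = T" using ex uv(4) by blast
    have "slide J K" by (rule slide_if_set_diff[OF pJ K(1)]) (use uv J K in \<open>auto simp: arcs\<close>)
    then have "reach V I K" using J pJ K by (auto simp: move_def intro: rtranclp.rtrancl_into_rtrancl)
    then show ?case using K by blast
  qed
  show ?thesis
  proof
    assume jn: "joined k V"
    then obtain I where "packed V I" "length I = k" by (auto simp: joined_def)
    then have "?F \<noteq> {}" using indep by blast
    moreover have "(S, T) \<in> rtrancl_on ?F (parcs ?T)" if ST: "S \<in> ?F" "T \<in> ?F" for S T
    proof -
      obtain I J where I: "packed V I" "length I = k" "set I = S"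
        and J: "packed V J" "length J = k" "set J = T" using ex ST by blast
      then have "reach V I J" using jn by (simp add: joined_def)
      then show ?thesis using fwd I J by blast
    qed
    ultimately show "Digraph_Component.connected (with_proj ?T)" using conn by blast
  next
    assume c: "Digraph_Component.connected (with_proj ?T)"
    then obtain S where "S \<in> ?F" using conn by blast
    then have "\<exists>I. packed V I \<and> length I = k" using ex by blast
    moreover have "reach V I J" if I: "packed V I" "length I = k" and J: "packed V J" "length J = k" for I J
    proof -
      have "(set I, set J) \<in> rtrancl_on ?F (parcs ?T)" using c conn indep I J by blast
      then obtain K where K: "reach V I K" "set K = set J" using bwd I by blast
      then have "K = J" using packed_unique reach_packed I J by blast
      then show ?thesis using K by simp
    qed
    ultimately show "joined k V" by (simp add: joined_def)
  qed
qed

lemma far_0: "far 0 S v" and joined_0: "joined 0 S"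
  by (auto simp: far_def joined_def before_def intro!: exI[of _ "[]"])

text \<open>\<open>joined\<close> demands a configuration to exist, and its tokens are distinct.
  This is what caps the number of rounds when \<open>k\<close> is huge.\<close>

lemma joined_bound: "joined j V \<Longrightarrow> j \<le> card V"
  using packed_distinct packed_subset finite_V
  by (auto simp: joined_def) (metis card_mono distinct_card order_refl)

end

section \<open>Orienting the complement of an interval graph\<close>

text \<open>Until the iteration becomes stationary, every step adds an element of
  \<open>U\<close>.\<close>

lemma inflationary_stabilizes:
  fixes f :: "'a set \<Rightarrow> 'a set"
  assumes "finite U" "X \<subseteq> U" "\<And>Y. Y \<subseteq> U \<Longrightarrow> f Y \<subseteq> U" "\<And>Y. Y \<subseteq> f Y"
  shows "f ((f ^^ card U) X) = (f ^^ card U) X"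
proof -
  have sub: "(f ^^ i) X \<subseteq> U" for i by (induction i) (use assms in auto)
  have "f ((f ^^ i) X) = (f ^^ i) X \<or> i \<le> card ((f ^^ i) X)" for i
  proof (induction i)
    case (Suc i)
    show ?case
    proof (cases "f ((f ^^ i) X) = (f ^^ i) X")
      case False
      then have "(f ^^ i) X \<subset> (f ^^ Suc i) X" using assms(4) by auto
      moreover have "finite ((f ^^ Suc i) X)" using sub assms(1) finite_subset by meson
      ultimately have "card ((f ^^ i) X) < card ((f ^^ Suc i) X)" by (rule psubset_card_mono[rotated])
      then show ?thesis using Suc False by linarith
    qed simp
  qed simp
  then consider "f ((f ^^ card U) X) = (f ^^ card U) X" | "card U \<le> card ((f ^^ card U) X)" by blast
  then show ?thesis
  proof cases
    case 2
    then have "(f ^^ card U) X = U" using sub assms(1) card_seteq by blast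
    then show ?thesis using assms(3)[of U] assms(4)[of U] by auto
  qed
qed

text \<open>\<open>P\<close> is the order of some interval model. It serves the correctness proof;
  the program sees \<open>A\<close> alone.\<close>

locale cocomparability =
  fixes n :: nat and A P :: "nat \<Rightarrow> nat \<Rightarrow> bool"
  assumes A_irrefl: "\<not> A a a"
    and A_sym: "A a b \<Longrightarrow> A b a"
    and A_verts: "A a b \<Longrightarrow> a < n \<and> b < n"
    and P_non: "P a b \<Longrightarrow> a < n \<and> b < n \<and> a \<noteq> b \<and> \<not> A a b"
    and P_total: "a < n \<Longrightarrow> b < n \<Longrightarrow> a \<noteq> b \<Longrightarrow> \<not> A a b \<Longrightarrow> P a b \<or> P b a"
    and P_ferrers: "P a b \<Longrightarrow> P c d \<Longrightarrow> P a d \<or> P c b"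
begin

section \<open>Forcing between nonadjacent pairs\<close>

definition non :: "(nat \<times> nat) set" where
  "non = {(a, b). a < n \<and> b < n \<and> a \<noteq> b \<and> \<not> A a b}"

text \<open>Gallai's relation: if \<open>a\<close> and \<open>c\<close> are adjacent, a transitive
  orientation placing \<open>a\<close> before \<open>b\<close> must place \<open>c\<close> before
  \<open>b\<close>, since otherwise \<open>a\<close> would precede \<open>c\<close>. The classes of
  its transitive closure are the implication classes.\<close>

inductive forces :: "nat \<times> nat \<Rightarrow> nat \<times> nat \<Rightarrow> bool" where
  forces_fst: "(a, b) \<in> non \<Longrightarrow> (c, b) \<in> non \<Longrightarrow> A a c \<Longrightarrow> forces (a, b) (c, b)"
| forces_snd: "(a, b) \<in> non \<Longrightarrow> (a, c) \<in> non \<Longrightarrow> A b c \<Longrightarrow> forces (a, b) (a, c)"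

lemma non_sym: "(a, b) \<in> non \<Longrightarrow> (b, a) \<in> non"
  using A_sym by (auto simp: non_def)

lemma finite_non: "finite non" and card_non: "card non \<le> n * n"
proof -
  have "non \<subseteq> {..<n} \<times> {..<n}" by (auto simp: non_def)
  from finite_subset[OF this] card_mono[OF _ this]
  show "finite non" "card non \<le> n * n" by simp_all
qed

lemma forces_sym: "forces p q \<Longrightarrow> forces q p"
  by (induction rule: forces.induct) (auto intro: forces.intros dest: A_sym)

lemma forces_star_sym: "forces\<^sup>*\<^sup>* p q \<Longrightarrow> forces\<^sup>*\<^sup>* q p"
  by (metis forces_sym sympD sympI symp_rtranclp)

lemma forces_swap: "forces p q \<Longrightarrow> forces (prod.swap p) (prod.swap q)"
  by (induction rule: forces.induct) (auto intro: forces.intros non_sym)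

lemma forces_star_swap: "forces\<^sup>*\<^sup>* p q \<Longrightarrow> forces\<^sup>*\<^sup>* (prod.swap p) (prod.swap q)"
  by (induction rule: rtranclp_induct) (auto intro: rtranclp.rtrancl_into_rtrancl forces_swap)

lemma forces_star_non: "forces\<^sup>*\<^sup>* p q \<Longrightarrow> p \<in> non \<Longrightarrow> q \<in> non"
  by (induction rule: rtranclp_induct) (auto elim: forces.cases)

lemma P_trans: "P a b \<Longrightarrow> P b c \<Longrightarrow> P a c"
  using P_ferrers P_non by blast

lemma P_antisym: "P a b \<Longrightarrow> \<not> P b a"
  using P_trans P_non by blast

lemma forces_P: "forces p q \<Longrightarrow> P (fst p) (snd p) \<Longrightarrow> P (fst q) (snd q)"
proof (induction rule: forces.induct)
  case (forces_fst a b c)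
  have "P c b \<or> P b c" using forces_fst(2) P_total by (auto simp: non_def)
  then show ?case using forces_fst P_trans P_non by fastforce
next
  case (forces_snd a b c)
  have "P a c \<or> P c a" using forces_snd(2) P_total by (auto simp: non_def)
  then show ?case using forces_snd P_trans P_non A_sym by (metis fst_conv snd_conv)
qed

lemma forces_star_P: "forces\<^sup>*\<^sup>* p q \<Longrightarrow> P (fst p) (snd p) \<Longrightarrow> P (fst q) (snd q)"
  by (induction rule: rtranclp_induct) (auto intro: forces_P)

text \<open>\<open>P\<close> keeps its direction along forcing, so a class meeting its own reverse
  would contradict antisymmetry of \<open>P\<close>. Every class can therefore be directed as a
  whole.\<close>

lemma not_forces_swap:
  assumes "p \<in> non" shows "\<not> forces\<^sup>*\<^sup>* p (prod.swap p)"
proof -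
  obtain a b where p: "p = (a, b)" by force
  have "P a b \<or> P b a" using assms P_total p by (auto simp: non_def)
  then show ?thesis
    using forces_star_P[of p "prod.swap p"] forces_star_P[of "prod.swap p" p] forces_star_sym
      P_antisym p by fastforce
qed

text \<open>Forcing stated as a first-order condition on a table, ready to become
  \<open>closure_fm\<close>.\<close>

definition closure_step :: "(nat \<times> nat) set \<Rightarrow> (nat \<times> nat) set" where
  "closure_step D = D \<union> {(x, y). x \<noteq> y \<and> \<not> A x y \<and>
     (\<exists>z < n. (z, y) \<in> D \<and> A z x \<or> (x, z) \<in> D \<and> A z y)}"

lemma closure_step_eq:
  assumes "D \<subseteq> non" shows "closure_step D = D \<union> {q. \<exists>p \<in> D. forces p q}"
proof (intro equalityI subsetI)
  fix q assume "q \<in> closure_step D"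
  then consider "q \<in> D"
    | x y z where "q = (x, y)" "x \<noteq> y" "\<not> A x y" "(z, y) \<in> D" "A z x"
    | x y z where "q = (x, y)" "x \<noteq> y" "\<not> A x y" "(x, z) \<in> D" "A z y"
    by (auto simp: closure_step_def)
  then show "q \<in> D \<union> {q. \<exists>p \<in> D. forces p q}"
  proof cases
    case (2 x y z)
    then have "forces (z, y) q" using assms A_verts by (auto simp: non_def intro!: forces_fst)
    then show ?thesis using 2 by blast
  next
    case (3 x y z)
    then have "forces (x, z) q" using assms A_verts by (auto simp: non_def intro!: forces_snd)
    then show ?thesis using 3 by blast
  qed simp
next
  fix q assume "q \<in> D \<union> {q. \<exists>p \<in> D. forces p q}"
  then show "q \<in> closure_step D"
    by (auto simp: closure_step_def non_def elim!: forces.cases)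
qed

text \<open>The closure is stationary after \<open>card non\<close> steps. The count
  \<open>n * n\<close> is at least that and is what two nested loops over the vertices
  provide.\<close>

lemma closure_iterate:
  assumes "D \<subseteq> non"
  shows "(closure_step ^^ (n * n)) D = {q. \<exists>p \<in> D. forces\<^sup>*\<^sup>* p q}"
proof -
  define f where "f D = D \<union> {q. \<exists>p \<in> D. forces p q}" for D
  have fn: "f Y \<subseteq> non" if "Y \<subseteq> non" for Y
    using that by (auto simp: f_def elim: forces.cases)
  have it: "(closure_step ^^ i) D = (f ^^ i) D \<and> (f ^^ i) D \<subseteq> non" for i
    by (induction i) (use assms fn closure_step_eq in \<open>auto simp: f_def\<close>)
  have stab: "f ((f ^^ card non) D) = (f ^^ card non) D"
    by (rule inflationary_stabilizes) (use assms fn finite_non in \<open>auto simp: f_def\<close>)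
  have "(f ^^ (i + card non)) D = (f ^^ card non) D" for i
    by (induction i) (use stab in auto)
  from this[of "n * n - card non"] have eq: "(f ^^ (n * n)) D = (f ^^ card non) D"
    using card_non by simp
  have "(f ^^ i) D \<subseteq> {q. \<exists>p \<in> D. forces\<^sup>*\<^sup>* p q}" for i
  proof (induction i)
    case (Suc i)
    show ?case
    proof
      fix q assume "q \<in> (f ^^ Suc i) D"
      then consider "q \<in> (f ^^ i) D" | q' where "q' \<in> (f ^^ i) D" "forces q' q"
        by (auto simp: f_def)
      then show "q \<in> {q. \<exists>p \<in> D. forces\<^sup>*\<^sup>* p q}"
      proof cases
        case 2
        then obtain p where "p \<in> D" "forces\<^sup>*\<^sup>* p q'" using Suc by blast
        then show ?thesis using 2(2) rtranclp.rtrancl_into_rtrancl by fast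
      qed (use Suc in blast)
    qed
  qed auto
  moreover have "q \<in> (f ^^ card non) D" if "forces\<^sup>*\<^sup>* p q" "p \<in> D" for p q
    using that(1)
  proof (induction rule: rtranclp_induct)
    case base
    have "D \<subseteq> (f ^^ i) D" for i by (induction i) (auto simp: f_def)
    then show ?case using that by auto
  next
    case (step q q')
    then have "q' \<in> f ((f ^^ card non) D)" by (auto simp: f_def[of "(f ^^ card non) D"])
    then show ?case using stab by simp
  qed
  ultimately have "(f ^^ card non) D = {q. \<exists>p \<in> D. forces\<^sup>*\<^sup>* p q}" by blast
  then show ?thesis using eq it by simp
qed

section \<open>Lexicographic orientation\<close>

definition lexle :: "nat \<times> nat \<Rightarrow> nat \<times> nat \<Rightarrow> bool" where
  "lexle p q \<longleftrightarrow> fst p < fst q \<or> fst p = fst q \<and> snd p \<le> snd q"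

text \<open>\<open>Q\<close> collects the pairs already processed. The last conjunct records the
  lexicographic rule: of a class and its reverse, \<open>D\<close> keeps the one that contains the
  least pair of both. Transitivity rests on it.\<close>

definition oriented :: "(nat \<times> nat) set \<Rightarrow> (nat \<times> nat) set \<Rightarrow> bool" where
  "oriented Q D \<longleftrightarrow> D \<subseteq> non \<and> (\<forall>p q. p \<in> D \<and> forces\<^sup>*\<^sup>* p q \<longrightarrow> q \<in> D) \<and>
     (\<forall>p \<in> D. prod.swap p \<notin> D) \<and> (\<forall>p \<in> Q \<inter> non. p \<in> D \<or> prod.swap p \<in> D) \<and>
     (\<forall>p \<in> D. \<exists>m \<in> D. forces\<^sup>*\<^sup>* p m \<and>
        (\<forall>q. forces\<^sup>*\<^sup>* p q \<longrightarrow> lexle m q \<and> lexle m (prod.swap q)))"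

lemma oriented_empty: "oriented {} {}"
  by (simp add: oriented_def)

text \<open>The pairs preceding \<open>(i, j)\<close> form
  \<open>{q. \<not> lexle (i, j) q}\<close>. If \<open>(i, j)\<close> is undecided, so are its whole
  class and the reverse class, because \<open>D\<close> is closed; as all earlier pairs are decided,
  \<open>(i, j)\<close> is the least pair of both classes.\<close>

lemma oriented_step:
  assumes D: "oriented {q. \<not> lexle (i, j) q} D"
  defines "D' \<equiv> D \<union> (if (i, j) \<in> non \<and> (j, i) \<notin> D then {(i, j)} else {})"
  shows "oriented (insert (i, j) {q. \<not> lexle (i, j) q}) ((closure_step ^^ (n * n)) D')"
proof -
  note c1 = D[unfolded oriented_def]
  note c2 = c1[THEN conjunct2] note c3 = c2[THEN conjunct2] note c4 = c3[THEN conjunct2]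
  have sub: "D \<subseteq> non" using c1 by (rule conjunct1)
  have closed: "q \<in> D" if "p \<in> D" "forces\<^sup>*\<^sup>* p q" for p q
    using c2[THEN conjunct1] that by blast
  have anti: "prod.swap p \<notin> D" if "p \<in> D" for p
    using c3[THEN conjunct1] that by blast
  have total: "p \<in> D \<or> prod.swap p \<in> D" if "\<not> lexle (i, j) p" "p \<in> non" for p
    using c4[THEN conjunct1] that by blast
  note least = c4[THEN conjunct2, rule_format]
  have "D' \<subseteq> non" using sub by (auto simp: D'_def)
  note cl = closure_iterate[OF this]
  show ?thesis
  proof (cases "(i, j) \<in> non \<and> (i, j) \<notin> D \<and> (j, i) \<notin> D")
    case False
    then have D': "D' = D" by (auto simp: D'_def)
    have "(closure_step ^^ (n * n)) D' = D" unfolding cl unfolding D' using closed by blast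
    moreover have "p \<in> D \<or> prod.swap p \<in> D"
      if "p \<in> insert (i, j) {q. \<not> lexle (i, j) q} \<inter> non" for p
      using that total[of p] False by auto
    ultimately show ?thesis unfolding oriented_def using sub c2 c3 c4 by simp
  next
    case True
    define X where "X = {q. forces\<^sup>*\<^sup>* (i, j) q}"
    have D': "D' = insert (i, j) D" using True by (auto simp: D'_def)
    have eq: "(closure_step ^^ (n * n)) D' = D \<union> X"
      unfolding cl unfolding D' X_def using closed by blast
    have X_non: "X \<subseteq> non" using forces_star_non True by (auto simp: X_def)
    have XD: "q \<notin> D" if "q \<in> X" for q using that closed True forces_star_sym unfolding X_def by blast
    have XD': "prod.swap q \<notin> D" if "q \<in> X" for q
    proof
      assume "prod.swap q \<in> D"
      moreover have "forces\<^sup>*\<^sup>* (prod.swap q) (j, i)"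
        using forces_star_swap[OF forces_star_sym] that by (fastforce simp: X_def)
      ultimately show False using closed True by blast
    qed
    have XX: "prod.swap q \<notin> X" if "q \<in> X" for q
    proof
      assume "prod.swap q \<in> X"
      then have "forces\<^sup>*\<^sup>* q (prod.swap q)"
        using that forces_star_sym[of "(i, j)" q] rtranclp_trans[of forces q "(i, j)" "prod.swap q"]
        by (simp add: X_def)
      then show False using not_forces_swap that X_non by blast
    qed
    have min: "lexle (i, j) q \<and> lexle (i, j) (prod.swap q)" if "q \<in> X" for q
    proof -
      have "q \<in> non" "prod.swap q \<in> non" using that X_non non_sym by (auto simp: prod.swap_def)
      then show ?thesis using total XD[OF that] XD'[OF that] swap_swap by metis
    qed
    have ijX: "(i, j) \<in> X" by (simp add: X_def)
    show ?thesis unfolding eq oriented_def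
    proof (intro conjI ballI allI impI)
      show "D \<union> X \<subseteq> non" using sub X_non by auto
      show "q \<in> D \<union> X" if "p \<in> D \<union> X \<and> forces\<^sup>*\<^sup>* p q" for p q
        using that closed[of p q] rtranclp_trans[of forces "(i, j)" p q] by (auto simp: X_def)
      show "prod.swap p \<notin> D \<union> X" if "p \<in> D \<union> X" for p
        using that anti XX XD' XD by (metis Un_iff swap_swap)
      show "p \<in> D \<union> X \<or> prod.swap p \<in> D \<union> X"
        if "p \<in> insert (i, j) {q. \<not> lexle (i, j) q} \<inter> non" for p
        using that total ijX by blast
      fix p assume p: "p \<in> D \<union> X"
      show "\<exists>m \<in> D \<union> X. forces\<^sup>*\<^sup>* p m \<and> (\<forall>q. forces\<^sup>*\<^sup>* p q \<longrightarrow> lexle m q \<and> lexle m (prod.swap q))"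
      proof (cases "p \<in> D")
        case False
        then have pX: "p \<in> X" using p by simp
        then have "forces\<^sup>*\<^sup>* p (i, j)" using forces_star_sym by (simp add: X_def)
        moreover have "q \<in> X" if "forces\<^sup>*\<^sup>* p q" for q
          using that pX rtranclp_trans[of forces "(i, j)" p q] by (simp add: X_def)
        ultimately show ?thesis using ijX min by blast
      qed (use least in blast)
    qed
  qed
qed

context
  fixes D assumes D: "oriented ({..<n} \<times> {..<n}) D"
begin

lemma D_non: "(a, b) \<in> D \<Longrightarrow> (a, b) \<in> non"
  using D by (auto simp: oriented_def)

lemma D_closed: "p \<in> D \<Longrightarrow> forces\<^sup>*\<^sup>* p q \<Longrightarrow> q \<in> D"
  using D unfolding oriented_def by blast

lemma D_antisym: "(a, b) \<in> D \<Longrightarrow> (b, a) \<notin> D"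
  using D by (fastforce simp: oriented_def)

lemma D_total: "(a, b) \<in> non \<Longrightarrow> (a, b) \<in> D \<or> (b, a) \<in> D"
  using D by (fastforce simp: oriented_def non_def)

text \<open>The triangle lemma of Gallai and Golumbic for the arc opposite to \<open>a\<close>.\<close>

lemma triangle:
  assumes "forces\<^sup>*\<^sup>* (b, c) (b', c')" "(a, b) \<in> D" "(b, c) \<in> D" "(c, a) \<in> D"
  shows "forces\<^sup>*\<^sup>* (a, b) (a, b') \<and> forces\<^sup>*\<^sup>* (c, a) (c', a)"
proof -
  have "forces\<^sup>*\<^sup>* (a, b) (a, fst q) \<and> forces\<^sup>*\<^sup>* (c, a) (snd q, a)" if "forces\<^sup>*\<^sup>* (b, c) q" for q
    using that
  proof (induction rule: rtranclp_induct)
    case (step q q')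
    obtain x y where q: "q = (x, y)" by force
    have tri: "(a, x) \<in> D" "(x, y) \<in> D" "(y, a) \<in> D"
      using step.IH step.hyps(1) assms D_closed q by auto
    have q'D: "q' \<in> D" using D_closed[OF tri(2)] step.hyps(2) q by blast
    from step.hyps(2)[unfolded q] show ?case
    proof (cases rule: forces.cases)
      case (forces_fst z)
      \<comment> \<open>If \<open>a\<close> and \<open>z\<close> were adjacent,
        \<open>(y, a)\<close> would force \<open>(y, z)\<close>, although \<open>(z, y)\<close>
        belongs to \<open>D\<close>.\<close>
      have "(a, z) \<in> non"
      proof (rule ccontr)
        assume "(a, z) \<notin> non"
        then have "a = z \<or> A a z" using tri forces_fst D_non by (auto simp: non_def)
        moreover have "forces (y, a) (y, z)" if "A a z"
          using that D_non tri forces_fst non_sym by (auto intro: forces_snd)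
        ultimately have "(y, z) \<in> D" using tri D_closed[OF tri(3)] by blast
        then show False using q'D forces_fst D_antisym by auto
      qed
      then have "forces (a, x) (a, z)" using forces_fst D_non tri by (auto intro: forces_snd)
      then show ?thesis using step.IH q forces_fst by auto
    next
      case (forces_snd z)
      have "(z, a) \<in> non"
      proof (rule ccontr)
        assume "(z, a) \<notin> non"
        then have "a = z \<or> A a z" using tri forces_snd D_non A_sym by (auto simp: non_def)
        moreover have "forces (a, x) (z, x)" if "A a z"
          using that D_non tri forces_snd non_sym by (auto intro: forces_fst)
        ultimately have "(z, x) \<in> D" using tri D_closed[OF tri(1)] by blast
        then show False using q'D forces_snd D_antisym by auto
      qed
      then have "forces (y, a) (z, a)" using forces_snd D_non tri by (auto intro: forces_fst)
      then show ?thesis using step.IH q forces_snd by auto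
    qed
  qed simp
  from this[OF assms(1)] show ?thesis by simp
qed

definition least_of :: "nat \<times> nat \<Rightarrow> nat \<times> nat \<Rightarrow> bool" where
  "least_of p m \<longleftrightarrow> m \<in> D \<and> forces\<^sup>*\<^sup>* p m \<and>
     (\<forall>q. forces\<^sup>*\<^sup>* p q \<longrightarrow> lexle m q \<and> lexle m (prod.swap q))"

lemma least_of_exists: "p \<in> D \<Longrightarrow> \<exists>m. least_of p m"
  using D unfolding oriented_def least_of_def by blast

text \<open>By \<open>triangle\<close>, \<open>(p, q)\<close> may replace \<open>(b, c)\<close> in
  the cycle. The class of \<open>(a, b)\<close> then contains \<open>(a, p)\<close>, so its least
  pair is at most the reverse \<open>(p, a)\<close>; being also at least \<open>(p, q)\<close>, it
  starts with \<open>p\<close>. Hence \<open>(a, p)\<close> forces some \<open>(p, q')\<close>, and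
  \<open>triangle\<close>, applied to the cycle rotated to begin at \<open>q\<close>, yields
  \<open>(q, p)\<close>.\<close>

lemma no_triangle_aux:
  assumes tri: "(a, b) \<in> D" "(b, c) \<in> D" "(c, a) \<in> D"
    and m: "least_of (b, c) (p, q)" "least_of (a, b) m'" "lexle (p, q) m'"
  shows False
proof -
  obtain p' q' where m': "m' = (p', q')" by force
  have t: "forces\<^sup>*\<^sup>* (a, b) (a, p)" "forces\<^sup>*\<^sup>* (c, a) (q, a)" "(p, q) \<in> D"
    using triangle[OF _ tri] m(1) by (auto simp: least_of_def)
  then have t': "(q, a) \<in> D" "(a, p) \<in> D" using tri D_closed by auto
  have "lexle m' (p, a)" using m(2) t(1) by (fastforce simp: least_of_def)
  then have "p' = p" using m(3) m' by (auto simp: lexle_def)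
  have "forces\<^sup>*\<^sup>* (a, p) (p, q')"
    using forces_star_sym[OF t(1)] m(2) m' \<open>p' = p\<close> by (auto simp: least_of_def intro: rtranclp_trans)
  from triangle[OF this t'(1,2) t(3)] have "(q, p) \<in> D" using D_closed t' by blast
  then show False using D_antisym t(3) by blast
qed

lemma lexle_linear: "lexle p q \<or> lexle q p"
  and lexle_trans: "lexle p q \<Longrightarrow> lexle q s \<Longrightarrow> lexle p s"
  by (auto simp: lexle_def)

text \<open>Least pairs cannot increase strictly all the way round a cycle, so some rotation meets
  the hypothesis of \<open>no_triangle_aux\<close>.\<close>

lemma no_triangle:
  assumes "(a, b) \<in> D" "(b, c) \<in> D" "(c, a) \<in> D" shows False
proof -
  obtain m1 m2 m3 where m: "least_of (a, b) m1" "least_of (b, c) m2" "least_of (c, a) m3"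
    using assms least_of_exists by meson
  consider "lexle m2 m1" | "lexle m3 m2" | "lexle m1 m3"
    using lexle_linear lexle_trans by blast
  then show False
    by cases (use no_triangle_aux assms m in \<open>metis surj_pair\<close>)+
qed

text \<open>If \<open>a\<close> and \<open>c\<close> were adjacent, \<open>(a, b)\<close> would
  force \<open>(c, b)\<close>; if \<open>D\<close> directed the pair from \<open>c\<close> to
  \<open>a\<close>, a directed triangle would arise.\<close>

lemma D_trans:
  assumes "(a, b) \<in> D" "(b, c) \<in> D" shows "(a, c) \<in> D"
proof -
  have ne: "a \<noteq> c" using assms D_antisym by blast
  have "\<not> A a c"
  proof
    assume "A a c"
    then have "forces (a, b) (c, b)" using assms D_non non_sym by (auto intro: forces_fst)
    then have "(c, b) \<in> D" using D_closed assms by blast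
    then show False using D_antisym assms by blast
  qed
  then have "(a, c) \<in> non" using ne assms D_non by (auto simp: non_def)
  then show ?thesis using D_total no_triangle assms by blast
qed

text \<open>Two incomparable arcs would span an induced 4-cycle.\<close>

lemma D_ferrers:
  assumes "(x, y) \<in> D" "(z, w) \<in> D" shows "(x, w) \<in> D \<or> (z, y) \<in> D"
proof (rule ccontr)
  assume neg: "\<not> ?thesis"
  have v: "x < n" "y < n" "z < n" "w < n" using assms D_non by (auto simp: non_def)
  have irr: "(u, u) \<notin> D" for u using D_antisym by blast
  have adj: "A u u'" if "u < n" "u' < n" "u \<noteq> u'" "(u, u') \<notin> D" "(u', u) \<notin> D" for u u'
    using that D_total by (auto simp: non_def)
  have "A x w" by (rule adj) (use v neg assms D_trans irr in blast)+
  moreover have "A z y" by (rule adj) (use v neg assms D_trans irr in blast)+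
  moreover have "A x z" by (rule adj) (use v neg assms D_trans irr in blast)+
  moreover have "A y w" by (rule adj) (use v neg assms D_trans irr in blast)+
  \<comment> \<open>However \<open>P\<close> directs these two pairs, \<open>P_ferrers\<close> makes
    one of the four cross pairs comparable, though all four are adjacent.\<close>
  moreover have "P x y \<or> P y x" "P z w \<or> P w z"
    using assms D_non P_total by (fastforce simp: non_def)+
  ultimately show False using P_ferrers P_non A_sym by meson
qed

end

end

text \<open>Sets of predecessors are nested by the Ferrers property, so their sizes serve as left
  ends, and a right end is put just before the earliest left end of a successor. The third clause is
  there for the program, which knows \<open>D\<close> but no endpoints and still has to compare
  right ends.\<close>

lemma ferrers_representation:
  fixes D :: "(nat \<times> nat) set"
  assumes sub: "D \<subseteq> {..<n} \<times> {..<n}" and irrefl: "\<And>x. (x, x) \<notin> D"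
    and ferrers: "\<And>x y z w. (x, y) \<in> D \<Longrightarrow> (z, w) \<in> D \<Longrightarrow> (x, w) \<in> D \<or> (z, y) \<in> D"
  shows "\<exists>l r :: nat \<Rightarrow> nat. (\<forall>v < n. l v \<le> r v) \<and>
    (\<forall>u < n. \<forall>v < n. (u, v) \<in> D \<longleftrightarrow> r u < l v) \<and>
    (\<forall>u < n. \<forall>v < n. r u < r v \<longleftrightarrow> (\<exists>z < n. (u, z) \<in> D \<and> (v, z) \<notin> D))"
proof -
  define l where "l v = card {z. (z, v) \<in> D}" for v
  \<comment> \<open>Without successors the right end is \<open>n\<close>, which no left end
    exceeds.\<close>
  define r where "r x = (if \<exists>y. (x, y) \<in> D then Min (l ` {y. (x, y) \<in> D}) - 1 else n)" for x
  have fin: "finite {z. (z, v) \<in> D}" "finite {z. (v, z) \<in> D}" for v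
    by (rule finite_subset[of _ "{..<n}"]; use sub in auto)+
  have l_n: "l v \<le> n" for v
    using card_mono[of "{..<n}" "{z. (z, v) \<in> D}"] sub by (auto simp: l_def)
  have l_pos: "0 < l y" if "(x, y) \<in> D" for x y
    using that fin by (auto simp: l_def card_gt_0_iff)
  have r_ex: "\<exists>z. (x, z) \<in> D \<and> l z = Suc (r x)" if "(x, y) \<in> D" for x y
  proof -
    have "Min (l ` {y. (x, y) \<in> D}) \<in> l ` {y. (x, y) \<in> D}"
      by (rule Min_in) (use fin that in auto)
    then obtain z where "(x, z) \<in> D" "l z = Min (l ` {y. (x, y) \<in> D})" by force
    then show ?thesis using l_pos[of x z] that by (auto simp: r_def)
  qed
  have r_less: "r x < l y" if "(x, y) \<in> D" for x y
  proof -
    have "Min (l ` {y. (x, y) \<in> D}) \<le> l y" by (rule Min_le) (use fin that in auto)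
    then show ?thesis using that l_pos[OF that] by (auto simp: r_def)
  qed
  have nested: "{z. (z, y) \<in> D} \<subseteq> {z. (z, v) \<in> D}" if "l y \<le> l v" for y v
  proof (rule ccontr)
    assume "\<not> ?thesis"
    then obtain z where z: "(z, y) \<in> D" "(z, v) \<notin> D" by auto
    then have "{z. (z, v) \<in> D} \<subset> {z. (z, y) \<in> D}" using ferrers by blast
    then have "l v < l y" unfolding l_def by (rule psubset_card_mono[OF fin(1)])
    then show False using that by simp
  qed
  have D_iff: "(u, v) \<in> D \<longleftrightarrow> r u < l v" for u v
  proof
    assume lt: "r u < l v"
    then obtain y where "(u, y) \<in> D" using l_n[of v] by (auto simp: r_def split: if_splits)
    then obtain z where "(u, z) \<in> D" "l z = Suc (r u)" using r_ex by blast
    then show "(u, v) \<in> D" using nested[of z v] lt by auto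
  qed (rule r_less)
  have l_le_r: "l v \<le> r v" for v
    using D_iff[of v v] irrefl[of v] by simp
  have r_less_iff: "r u < r v \<longleftrightarrow> (\<exists>z < n. (u, z) \<in> D \<and> (v, z) \<notin> D)" if "u < n" "v < n" for u v
  proof
    assume lt: "r u < r v"
    have "r v \<le> n"
    proof (cases "\<exists>y. (v, y) \<in> D")
      case True
      then show ?thesis using r_ex[of v] l_n by (metis Suc_leD)
    qed (simp add: r_def)
    then obtain y where "(u, y) \<in> D" using lt by (auto simp: r_def[of u] split: if_splits)
    then obtain z where z: "(u, z) \<in> D" "l z = Suc (r u)" using r_ex by blast
    then have "(v, z) \<notin> D" using lt D_iff by auto
    then show "\<exists>z < n. (u, z) \<in> D \<and> (v, z) \<notin> D" using z(1) sub by auto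
  qed (use D_iff in fastforce)
  show ?thesis
    by (intro exI[of _ l] exI[of _ r] conjI allI impI) (assumption | rule l_le_r D_iff r_less_iff)+
qed

section \<open>Definable queries are polynomial-time computable\<close>

text \<open>A small query language is compiled once and for all, so that no individual query needs a
  machine program and a timing proof of its own.\<close>

datatype fm =
    FRel nat nat nat
  | FEq nat nat
  | FSucK nat
  | FPosK
  | FNot fm
  | FAnd fm fm
  | FEx nat fm

primrec fval :: "nat \<Rightarrow> nat \<Rightarrow> fm \<Rightarrow> (nat \<Rightarrow> nat) \<Rightarrow> (nat \<Rightarrow> nat \<Rightarrow> nat \<Rightarrow> bool) \<Rightarrow> bool" where
  "fval n k (FRel t x y) e R \<longleftrightarrow> R t (e x) (e y)"
| "fval n k (FEq x y) e R \<longleftrightarrow> e x = e y"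
| "fval n k (FSucK x) e R \<longleftrightarrow> Suc (e x) < k"
| "fval n k FPosK e R \<longleftrightarrow> 0 < k"
| "fval n k (FNot \<phi>) e R \<longleftrightarrow> \<not> fval n k \<phi> e R"
| "fval n k (FAnd \<phi> \<psi>) e R \<longleftrightarrow> fval n k \<phi> e R \<and> fval n k \<psi> e R"
| "fval n k (FEx x \<phi>) e R \<longleftrightarrow> (\<exists>i < n. fval n k \<phi> (e(x := i)) R)"

text \<open>Variables are numbered by binding depth, so that nested loops never share a counter.\<close>

primrec scoped :: "fm \<Rightarrow> nat \<Rightarrow> bool" where
  "scoped (FRel t x y) m \<longleftrightarrow> x < m \<and> y < m"
| "scoped (FEq x y) m \<longleftrightarrow> x < m \<and> y < m"
| "scoped (FSucK x) m \<longleftrightarrow> x < m"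
| "scoped FPosK m \<longleftrightarrow> True"
| "scoped (FNot \<phi>) m \<longleftrightarrow> scoped \<phi> m"
| "scoped (FAnd \<phi> \<psi>) m \<longleftrightarrow> scoped \<phi> m \<and> scoped \<psi> m"
| "scoped (FEx x \<phi>) m \<longleftrightarrow> x = m \<and> scoped \<phi> (Suc m)"

text \<open>Loops run exactly \<open>n\<close> times and the nesting depth is fixed by the program,
  which makes the time polynomial automatically.\<close>

datatype prog =
    Update nat fm
  | Then prog prog
  | For prog

primrec run :: "nat \<Rightarrow> nat \<Rightarrow> prog \<Rightarrow> nat \<Rightarrow> (nat \<Rightarrow> nat) \<Rightarrow>
    (nat \<Rightarrow> nat \<Rightarrow> nat \<Rightarrow> bool) \<Rightarrow> nat \<Rightarrow> nat \<Rightarrow> nat \<Rightarrow> bool" where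
  "run n k (Update t \<phi>) m e R = R(t := \<lambda>x y. fval n k \<phi> (e(m := x, Suc m := y)) R)"
| "run n k (Then p q) m e R = run n k q m e (run n k p m e R)"
| "run n k (For p) m e R = fold (\<lambda>i. run n k p (Suc m) (e(m := i))) [0..<n] R"

primrec scoped_prog :: "prog \<Rightarrow> nat \<Rightarrow> bool" where
  "scoped_prog (Update t \<phi>) m \<longleftrightarrow> scoped \<phi> (Suc (Suc m))"
| "scoped_prog (Then p q) m \<longleftrightarrow> scoped_prog p m \<and> scoped_prog q m"
| "scoped_prog (For p) m \<longleftrightarrow> scoped_prog p (Suc m)"

text \<open>Unary words over different letters give infinite families of names without clashes;
  \<open>tab 0\<close> is the input array.\<close>

definition var :: "nat \<Rightarrow> vname" where "var i = CHR ''v'' # replicate i CHR ''v''"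
definition flag :: "nat \<Rightarrow> vname" where "flag i = CHR ''f'' # replicate i CHR ''f''"
definition tab :: "nat \<Rightarrow> vname" where "tab i = CHR ''A'' # replicate i CHR ''A''"

lemma names [simp]:
  "var i = var j \<longleftrightarrow> i = j" "flag i = flag j \<longleftrightarrow> i = j" "tab i = tab j \<longleftrightarrow> i = j"
  "var i \<noteq> flag j" "flag i \<noteq> var j" "var i \<noteq> tab j" "tab i \<noteq> var j" "flag i \<noteq> tab j" "tab i \<noteq> flag j"
  "var i \<noteq> ''n''" "var i \<noteq> ''k''" "var i \<noteq> ''R''" "var i \<noteq> ''T''" "var i \<noteq> ''out''"
  "flag i \<noteq> ''n''" "flag i \<noteq> ''k''" "flag i \<noteq> ''R''" "flag i \<noteq> ''T''" "flag i \<noteq> ''out''"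
  "tab i \<noteq> ''n''" "tab i \<noteq> ''k''" "tab i \<noteq> ''R''" "tab i \<noteq> ''T''" "tab i \<noteq> ''out''"
  "''n'' \<noteq> var i" "''k'' \<noteq> var i" "''R'' \<noteq> var i" "''T'' \<noteq> var i"
  "''n'' \<noteq> flag i" "''k'' \<noteq> flag i" "''R'' \<noteq> flag i" "''T'' \<noteq> flag i"
  "''n'' \<noteq> tab i" "''k'' \<noteq> tab i" "''R'' \<noteq> tab i" "''T'' \<noteq> tab i"
  by (auto simp: var_def flag_def tab_def)

lemma tab_0: "tab 0 = ''A''"
  by (simp add: tab_def)

abbreviation scalar :: "vname \<Rightarrow> aexp" where "scalar x \<equiv> Cell x (Num 0)"

text \<open>The machine has no multiplication, so \<open>R\<close> holds the row offsets of the matrices.\<close>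

definition index :: "nat \<Rightarrow> nat \<Rightarrow> aexp" where
  "index x y = Plus (Cell ''R'' (scalar (var x))) (scalar (var y))"

definition loop :: "vname \<Rightarrow> com \<Rightarrow> com" where
  "loop v c = Seq (Assign v (Num 0) (Num 0))
     (While (Less (scalar v) (scalar ''n''))
        (Seq c (Assign v (Num 0) (Plus (scalar v) (Num 1)))))"

definition test :: "bexp \<Rightarrow> nat \<Rightarrow> com" where
  "test b d = Cond b (Assign (flag d) (Num 0) (Num 1)) (Assign (flag d) (Num 0) (Num 0))"

text \<open>The result is left in \<open>flag d\<close>. Flags below \<open>d\<close> hold pending
  results of enclosing formulas and must survive.\<close>

primrec compile_fm :: "fm \<Rightarrow> nat \<Rightarrow> com" where
  "compile_fm (FRel t x y) d = test (Less (Num 0) (Cell (tab t) (index x y))) d"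
| "compile_fm (FEq x y) d = test (Conj (Neg (Less (scalar (var x)) (scalar (var y))))
     (Neg (Less (scalar (var y)) (scalar (var x))))) d"
| "compile_fm (FSucK x) d = test (Less (Plus (scalar (var x)) (Num 1)) (scalar ''k'')) d"
| "compile_fm FPosK d = test (Less (Num 0) (scalar ''k'')) d"
| "compile_fm (FNot \<phi>) d = Seq (compile_fm \<phi> d) (test (Neg (Less (Num 0) (scalar (flag d)))) d)"
| "compile_fm (FAnd \<phi> \<psi>) d = Seq (compile_fm \<phi> d) (Seq (compile_fm \<psi> (Suc d))
     (test (Conj (Less (Num 0) (scalar (flag d))) (Less (Num 0) (scalar (flag (Suc d))))) d))"
| "compile_fm (FEx x \<phi>) d = Seq (Assign (flag d) (Num 0) (Num 0))
     (loop (var x) (Seq (compile_fm \<phi> (Suc d))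
        (Cond (Less (Num 0) (scalar (flag (Suc d)))) (Assign (flag d) (Num 0) (Num 1)) Skip)))"

definition loop2 :: "nat \<Rightarrow> com \<Rightarrow> com" where
  "loop2 m c = loop (var m) (loop (var (Suc m)) c)"

text \<open>An update is computed into the scratch array \<open>T\<close> and then copied, because
  the formula may read table \<open>t\<close> while its new entries are being determined.\<close>

primrec compile :: "prog \<Rightarrow> nat \<Rightarrow> com" where
  "compile (Update t \<phi>) m =
     Seq (loop2 m (Seq (compile_fm \<phi> 0) (Assign ''T'' (index m (Suc m)) (scalar (flag 0)))))
         (loop2 m (Assign (tab t) (index m (Suc m)) (Cell ''T'' (index m (Suc m)))))"
| "compile (Then p q) m = Seq (compile p m) (compile q m)"
| "compile (For p) m = loop (var m) (compile p (Suc m))"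

section \<open>Total correctness with time bounds\<close>

definition tc :: "(store \<Rightarrow> bool) \<Rightarrow> com \<Rightarrow> nat \<Rightarrow> (store \<Rightarrow> bool) \<Rightarrow> bool" where
  "tc P c B Q \<longleftrightarrow> (\<forall>s. P s \<longrightarrow> (\<exists>t s'. exec c s t s' \<and> t \<le> B \<and> Q s'))"

lemma tcI: "(\<And>s. P s \<Longrightarrow> \<exists>t s'. exec c s t s' \<and> t \<le> B \<and> Q s') \<Longrightarrow> tc P c B Q"
  by (simp add: tc_def)

lemma tc_Seq:
  assumes "tc P c B Q" "tc Q d C S" "1 + B + C \<le> E"
  shows "tc P (Seq c d) E S"
proof (rule tcI)
  fix s assume "P s"
  then obtain t s' where 1: "exec c s t s'" "t \<le> B" "Q s'" using assms(1) by (auto simp: tc_def)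
  then obtain t' s'' where "exec d s' t' s''" "t' \<le> C" "S s''" using assms(2) by (auto simp: tc_def)
  with 1 exec.Seq[OF 1(1) this(1)] assms(3)
  show "\<exists>t s'. exec (Seq c d) s t s' \<and> t \<le> E \<and> S s'" by fastforce
qed

lemma tc_Assign:
  assumes "\<And>s. P s \<Longrightarrow> Q (s(x := (s x)(aval e s := aval f s)))" "1 + acost e + acost f \<le> B"
  shows "tc P (Assign x e f) B Q"
  by (rule tcI) (use assms exec.Assign in blast)

lemma tc_Skip:
  assumes "\<And>s. P s \<Longrightarrow> Q s" "1 \<le> B" shows "tc P Skip B Q"
  by (rule tcI) (use assms exec.Skip in blast)

lemma tc_Cond:
  assumes "tc (\<lambda>s. P s \<and> bval b s) c B Q" "tc (\<lambda>s. P s \<and> \<not> bval b s) d B Q" "1 + bcost b + B \<le> E"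
  shows "tc P (Cond b c d) E Q"
proof (rule tcI)
  fix s assume P: "P s"
  show "\<exists>t s'. exec (Cond b c d) s t s' \<and> t \<le> E \<and> Q s'"
  proof (cases "bval b s")
    case True
    then obtain t s' where "exec c s t s'" "t \<le> B" "Q s'" using assms(1) P by (auto simp: tc_def)
    with exec.CondT[OF True this(1)] assms(3) show ?thesis by fastforce
  next
    case False
    then obtain t s' where "exec d s t s'" "t \<le> B" "Q s'" using assms(2) P by (auto simp: tc_def)
    with exec.CondF[OF False this(1)] assms(3) show ?thesis by fastforce
  qed
qed

lemma tc_weaken:
  assumes "tc P c B Q" "\<And>s. P' s \<Longrightarrow> P s" "B \<le> B'" "\<And>s. Q s \<Longrightarrow> Q' s"
  shows "tc P' c B' Q'"
  using assms unfolding tc_def by (meson le_trans)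

text \<open>The 13 units per pass are 6 for the loop test, 1 for the sequential composition and 6
  for the increment. \<open>Inv i\<close> is to hold when the counter has already become
  \<open>i\<close>, hence the updated store in the postcondition of the body.\<close>

lemma tc_loop:
  assumes body: "\<And>i. i < N \<Longrightarrow> tc (\<lambda>s. Inv i s \<and> s v 0 = i \<and> s ''n'' 0 = N) c B
      (\<lambda>s. Inv (Suc i) (s(v := (s v)(0 := Suc i))) \<and> s v 0 = i \<and> s ''n'' 0 = N)"
    and v: "v \<noteq> ''n''"
  shows "tc (\<lambda>s. Inv 0 (s(v := (s v)(0 := 0))) \<and> s ''n'' 0 = N) (loop v c) ((N + 1) * (B + 13))
      (\<lambda>s. Inv N s \<and> s ''n'' 0 = N)"
proof -
  let ?b = "Less (scalar v) (scalar ''n'')"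
  let ?c = "Seq c (Assign v (Num 0) (Plus (scalar v) (Num 1)))"
  have while: "\<exists>t s'. exec (While ?b ?c) s t s' \<and> t \<le> j * (B + 13) + 6 \<and> Inv N s' \<and> s' ''n'' 0 = N"
    if "i + j = N" "Inv i s" "s v 0 = i" "s ''n'' 0 = N" for i j s
    using that
  proof (induction j arbitrary: i s)
    case 0
    then have "exec (While ?b ?c) s (1 + bcost ?b) s" by (intro exec.WhileF) simp
    then show ?case using 0 by fastforce
  next
    case (Suc j)
    then obtain t s1 where 1: "exec c s t s1" "t \<le> B"
      "Inv (Suc i) (s1(v := (s1 v)(0 := Suc i)))" "s1 v 0 = i" "s1 ''n'' 0 = N"
      using body[of i] by (auto simp: tc_def)
    define s2 where "s2 = s1(v := (s1 v)(0 := Suc i))"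
    have "exec (Assign v (Num 0) (Plus (scalar v) (Num 1))) s1 6 s2"
      using exec.Assign[of v "Num 0" "Plus (scalar v) (Num 1)" s1] 1
      by (simp add: s2_def numeral_eq_Suc)
    from exec.Seq[OF 1(1) this] have 2: "exec ?c s (1 + t + 6) s2" .
    have "\<exists>t s'. exec (While ?b ?c) s2 t s' \<and> t \<le> j * (B + 13) + 6 \<and> Inv N s' \<and> s' ''n'' 0 = N"
    proof (rule Suc.IH)
      show "Inv (Suc i) s2" using 1(3) by (simp only: s2_def)
      show "s2 v 0 = Suc i" "s2 ''n'' 0 = N" using 1(5) v by (simp_all add: s2_def)
    qed (use Suc.prems in simp)
    then obtain t' s' where 3: "exec (While ?b ?c) s2 t' s'" "t' \<le> j * (B + 13) + 6"
      "Inv N s'" "s' ''n'' 0 = N" by blast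
    have "bval ?b s" using Suc.prems by simp
    from exec.WhileT[OF this 2 3(1)] show ?case using 1(2) 3 by fastforce
  qed
  show ?thesis
  proof (rule tcI)
    fix s assume P: "Inv 0 (s(v := (s v)(0 := 0))) \<and> s ''n'' 0 = N"
    define s1 where "s1 = s(v := (s v)(0 := 0))"
    have 1: "exec (Assign v (Num 0) (Num 0)) s 3 s1"
      using exec.Assign[of v "Num 0" "Num 0" s] by (simp add: s1_def numeral_eq_Suc)
    obtain t s' where 2: "exec (While ?b ?c) s1 t s'" "t \<le> N * (B + 13) + 6" "Inv N s'" "s' ''n'' 0 = N"
      using while[of 0 N s1] P v by (auto simp: s1_def)
    have "1 + 3 + t \<le> (N + 1) * (B + 13)" using 2(2) by (simp add: algebra_simps)
    with exec.Seq[OF 1 2(1)] 2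
    show "\<exists>t s'. exec (loop v c) s t s' \<and> t \<le> (N + 1) * (B + 13) \<and> Inv N s' \<and> s' ''n'' 0 = N"
      unfolding loop_def by blast
  qed
qed

section \<open>Correctness of compiled formulas and programs\<close>

definition models :: "nat \<Rightarrow> nat \<Rightarrow> nat \<Rightarrow> (nat \<Rightarrow> nat) \<Rightarrow> (nat \<Rightarrow> nat \<Rightarrow> nat \<Rightarrow> bool) \<Rightarrow> store \<Rightarrow> bool" where
  "models n k m e R s \<longleftrightarrow> s ''n'' 0 = n \<and> s ''k'' 0 = k \<and> (\<forall>i < n. s ''R'' i = i * n) \<and>
     (\<forall>t x y. x < n \<longrightarrow> y < n \<longrightarrow> (0 < s (tab t) (x * n + y) \<longleftrightarrow> R t x y)) \<and>
     (\<forall>i < m. s (var i) 0 = e i \<and> e i < n)"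

definition frame :: "nat \<Rightarrow> nat \<Rightarrow> store \<Rightarrow> store \<Rightarrow> bool" where
  "frame d m s s' \<longleftrightarrow> (\<forall>x. x \<notin> flag ` {d..} \<and> x \<notin> var ` {m..} \<longrightarrow> s' x = s x)"

lemma models_frame: "models n k m e R s \<Longrightarrow> frame d m s s' \<Longrightarrow> models n k m e R s'"
  by (auto simp: models_def frame_def image_iff)

lemma models_update_tmp: "models n k m e R (s(''T'' := f)) = models n k m e R s"
  and models_update_var: "m \<le> i \<Longrightarrow> models n k m e R (s(var i := f)) = models n k m e R s"
  by (auto simp: models_def)

lemma models_Suc_iff:
  "models n k (Suc m) (e(m := i)) R s \<longleftrightarrow> models n k m e R s \<and> s (var m) 0 = i \<and> i < n"
  by (auto simp: models_def less_Suc_eq)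

lemma models_index:
  "models n k m e R s \<Longrightarrow> x < m \<Longrightarrow> aval (index x y) s = e x * n + s (var y) 0"
  by (auto simp: models_def index_def)

lemma frame_trans: "frame d m s s' \<Longrightarrow> frame d m s' s'' \<Longrightarrow> frame d m s s''"
  and frame_mono: "frame d' m' s s' \<Longrightarrow> d \<le> d' \<Longrightarrow> m \<le> m' \<Longrightarrow> frame d m s s'"
  and frame_flag: "d \<le> i \<Longrightarrow> frame d m s (s(flag i := f))"
  by (auto simp: frame_def image_iff)

lemma tc_test:
  assumes "\<And>s. P s \<Longrightarrow> Q (s(flag d := (s (flag d))(0 := of_bool (bval b s))))" "4 + bcost b \<le> B"
  shows "tc P (test b d) B Q"
  unfolding test_def
  by (rule tc_Cond[where B = 3]; (rule tc_Assign)?) (use assms in \<open>auto dest: assms(1)\<close>)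

definition decides :: "nat \<Rightarrow> nat \<Rightarrow> nat \<Rightarrow> fm \<Rightarrow> nat \<Rightarrow> nat \<Rightarrow> bool" where
  "decides n k B \<phi> d m \<longleftrightarrow> (\<forall>e R s0. models n k m e R s0 \<longrightarrow>
     tc (\<lambda>s. s = s0) (compile_fm \<phi> d) B
       (\<lambda>s. frame d m s0 s \<and> s (flag d) 0 = of_bool (fval n k \<phi> e R)))"

lemma decides_atom:
  assumes "compile_fm \<phi> d = test b d" "4 + bcost b \<le> B"
    "\<And>e R s. models n k m e R s \<Longrightarrow> bval b s \<longleftrightarrow> fval n k \<phi> e R"
  shows "decides n k B \<phi> d m"
  unfolding decides_def assms(1)
  by (intro allI impI, rule tc_test) (use assms frame_flag in auto)

text \<open>The polynomial is chosen before \<open>n\<close> and \<open>k\<close>, so it depends on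
  the formula only. Each quantifier contributes a factor \<open>[:1, 1:]\<close>, that is
  \<open>n + 1\<close>; the numerical constants are generous.\<close>

lemma decides_exists:
  "scoped \<phi> m \<Longrightarrow> \<exists>p. \<forall>n k. decides n k (poly p n) \<phi> d m"
proof (induction \<phi> arbitrary: d m)
  case (FRel t x y)
  have "decides n k (poly [:100:] n) (FRel t x y) d m" for n k
  proof (rule decides_atom)
    fix e R s assume M: "models n k m e R s"
    then have "aval (index x y) s = e x * n + e y"
      using FRel models_index[OF M] by (auto simp: models_def)
    then show "bval (Less (Num 0) (Cell (tab t) (index x y))) s \<longleftrightarrow> fval n k (FRel t x y) e R"
      using M FRel by (auto simp: models_def)
  qed (auto simp: index_def)
  then show ?case by blast
next
  case (FEq x y)
  have "decides n k (poly [:100:] n) (FEq x y) d m" for n k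
    by (rule decides_atom) (use FEq in \<open>auto simp: models_def\<close>)
  then show ?case by blast
next
  case (FSucK x)
  have "decides n k (poly [:100:] n) (FSucK x) d m" for n k
    by (rule decides_atom) (use FSucK in \<open>auto simp: models_def\<close>)
  then show ?case by blast
next
  case FPosK
  have "decides n k (poly [:100:] n) FPosK d m" for n k
    by (rule decides_atom) (auto simp: models_def)
  then show ?case by blast
next
  case (FNot \<phi>)
  then obtain p where p: "\<And>n k. decides n k (poly p n) \<phi> d m" by fastforce
  have "decides n k (poly (p + [:100:]) n) (FNot \<phi>) d m" for n k
    unfolding decides_def compile_fm.simps
  proof (intro allI impI)
    fix e R s0 assume M: "models n k m e R s0"
    show "tc (\<lambda>s. s = s0) (Seq (compile_fm \<phi> d) (test (Neg (Less (Num 0) (scalar (flag d)))) d))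
      (poly (p + [:100:]) n) (\<lambda>s. frame d m s0 s \<and> s (flag d) 0 = of_bool (fval n k (FNot \<phi>) e R))"
      by (rule tc_Seq[OF p[unfolded decides_def, rule_format, OF M] tc_test[where B = 50]])
         (auto intro: frame_trans frame_flag)
  qed
  then show ?case by blast
next
  case (FAnd \<phi> \<psi>)
  then obtain p q where p: "\<And>n k. decides n k (poly p n) \<phi> d m"
    and q: "\<And>n k. decides n k (poly q n) \<psi> (Suc d) m" by (metis scoped.simps(6))
  have "decides n k (poly (p + q + [:100:]) n) (FAnd \<phi> \<psi>) d m" for n k
    unfolding decides_def compile_fm.simps
  proof (intro allI impI)
    fix e R s0 assume M: "models n k m e R s0"
    let ?P = "\<lambda>s. frame d m s0 s \<and> s (flag d) 0 = of_bool (fval n k \<phi> e R)"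
    let ?Q = "\<lambda>s. ?P s \<and> s (flag (Suc d)) 0 = of_bool (fval n k \<psi> e R)"
    have 2: "tc ?P (compile_fm \<psi> (Suc d)) (poly q n) ?Q"
    proof (rule tcI)
      fix s assume P: "?P s"
      then obtain t s' where "exec (compile_fm \<psi> (Suc d)) s t s'" "t \<le> poly q n"
        "frame (Suc d) m s s'" "s' (flag (Suc d)) 0 = of_bool (fval n k \<psi> e R)"
        using q[unfolded decides_def, rule_format, OF models_frame[OF M]] unfolding tc_def by blast
      moreover from this(3) have "s' (flag d) = s (flag d)" by (auto simp: frame_def image_iff)
      moreover have "frame d m s0 s'"
        using P frame_trans[OF _ frame_mono[OF calculation(3)], of d m] by simp
      ultimately show "\<exists>t s'. exec (compile_fm \<psi> (Suc d)) s t s' \<and> t \<le> poly q n \<and> ?Q s'"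
        using P by (intro exI[of _ t] exI[of _ s']) simp
    qed
    show "tc (\<lambda>s. s = s0) (Seq (compile_fm \<phi> d) (Seq (compile_fm \<psi> (Suc d))
        (test (Conj (Less (Num 0) (scalar (flag d))) (Less (Num 0) (scalar (flag (Suc d))))) d)))
      (poly (p + q + [:100:]) n)
      (\<lambda>s. frame d m s0 s \<and> s (flag d) 0 = of_bool (fval n k (FAnd \<phi> \<psi>) e R))"
      by (rule tc_Seq[OF p[unfolded decides_def, rule_format, OF M]
            tc_Seq[OF 2 tc_test[where B = 50] order_refl]])
         (auto intro: frame_trans frame_flag)
  qed
  then show ?case by blast
next
  case (FEx x \<phi>)
  then have x: "x = m" by simp
  obtain p where p: "\<And>n k. decides n k (poly p n) \<phi> (Suc d) (Suc m)" using FEx by fastforce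
  have "decides n k (poly ([:1, 1:] * (p + [:50:]) + [:50:]) n) (FEx x \<phi>) d m" for n k
    unfolding decides_def compile_fm.simps x
  proof (intro allI impI)
    fix e R s0 assume M: "models n k m e R s0"
    define Inv where "Inv i s \<longleftrightarrow> frame d m s0 s \<and>
      s (flag d) 0 = of_bool (\<exists>j < i. fval n k \<phi> (e(m := j)) R)" for i and s :: store
    let ?c = "Cond (Less (Num 0) (scalar (flag (Suc d)))) (Assign (flag d) (Num 0) (Num 1)) Skip"
    have Inv_var: "Inv i (s(var m := f)) \<longleftrightarrow> Inv i s" for i s f
      unfolding Inv_def frame_def by (auto simp: image_iff)
    have n_Inv: "s ''n'' 0 = n" if "Inv i s" for i s
      using that M unfolding Inv_def by (auto simp: frame_def models_def image_iff)
    have body: "tc (\<lambda>s. Inv i s \<and> s (var m) 0 = i \<and> s ''n'' 0 = n) (Seq (compile_fm \<phi> (Suc d)) ?c)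
      (poly p n + 30) (\<lambda>s. Inv (Suc i) (s(var m := (s (var m))(0 := Suc i))) \<and> s (var m) 0 = i \<and> s ''n'' 0 = n)"
      if i: "i < n" for i
    proof (rule tc_Seq)
      let ?Q = "\<lambda>s. Inv i s \<and> s (var m) 0 = i \<and>
        s (flag (Suc d)) 0 = of_bool (fval n k \<phi> (e(m := i)) R)"
      show "tc (\<lambda>s. Inv i s \<and> s (var m) 0 = i \<and> s ''n'' 0 = n) (compile_fm \<phi> (Suc d)) (poly p n) ?Q"
      proof (rule tcI)
        fix s assume P: "Inv i s \<and> s (var m) 0 = i \<and> s ''n'' 0 = n"
        then have "models n k (Suc m) (e(m := i)) R s"
          unfolding models_Suc_iff using M i models_frame by (auto simp: Inv_def)
        then obtain t s' where 1: "exec (compile_fm \<phi> (Suc d)) s t s'" "t \<le> poly p n"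
          "frame (Suc d) (Suc m) s s'" "s' (flag (Suc d)) 0 = of_bool (fval n k \<phi> (e(m := i)) R)"
          using p[unfolded decides_def, rule_format] unfolding tc_def by blast
        have "s' (var m) = s (var m)" "s' (flag d) = s (flag d)"
          using 1(3) by (auto simp: frame_def image_iff)
        moreover have "frame d m s0 s'"
          using P 1(3) frame_mono[OF 1(3), of d m] by (auto simp: Inv_def intro: frame_trans)
        ultimately show "\<exists>t s'. exec (compile_fm \<phi> (Suc d)) s t s' \<and> t \<le> poly p n \<and> ?Q s'"
          using P 1 by (intro exI[of _ t] exI[of _ s']) (simp add: Inv_def)
      qed
      show "tc ?Q ?c 20 (\<lambda>s. Inv (Suc i) (s(var m := (s (var m))(0 := Suc i))) \<and> s (var m) 0 = i \<and> s ''n'' 0 = n)"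
      proof (rule tc_Cond[where B = 3]; (rule tc_Assign tc_Skip)?)
        fix s assume Q: "?Q s \<and> bval (Less (Num 0) (scalar (flag (Suc d)))) s"
        let ?s = "s(flag d := (s (flag d))(aval (Num 0) s := aval (Num 1) s))"
        have "fval n k \<phi> (e(m := i)) R" using Q by (auto split: if_splits)
        then have "Inv (Suc i) ?s"
          using Q frame_flag[of d d m s] unfolding Inv_def by (auto intro: frame_trans)
        then show "Inv (Suc i) (?s(var m := (?s (var m))(0 := Suc i))) \<and> ?s (var m) 0 = i \<and> ?s ''n'' 0 = n"
          using Q n_Inv unfolding Inv_var by auto
      next
        fix s assume Q: "?Q s \<and> \<not> bval (Less (Num 0) (scalar (flag (Suc d)))) s"
        then have "\<not> fval n k \<phi> (e(m := i)) R" by auto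
        then have "Inv (Suc i) s" using Q unfolding Inv_def by (auto simp: less_Suc_eq)
        then show "Inv (Suc i) (s(var m := (s (var m))(0 := Suc i))) \<and> s (var m) 0 = i \<and> s ''n'' 0 = n"
          using Q n_Inv unfolding Inv_var by auto
      qed auto
    qed simp
    have fin: "Inv n s \<longleftrightarrow> frame d m s0 s \<and> s (flag d) 0 = of_bool (fval n k (FEx m \<phi>) e R)" for s
      unfolding Inv_def by simp
    have loop: "tc (\<lambda>s. Inv 0 (s(var m := (s (var m))(0 := 0))) \<and> s ''n'' 0 = n)
      (loop (var m) (Seq (compile_fm \<phi> (Suc d)) ?c)) ((n + 1) * (poly p n + 30 + 13))
      (\<lambda>s. Inv n s \<and> s ''n'' 0 = n)"
      by (rule tc_loop[OF body]) auto
    show "tc (\<lambda>s. s = s0) (Seq (Assign (flag d) (Num 0) (Num 0))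
        (loop (var m) (Seq (compile_fm \<phi> (Suc d)) ?c))) (poly ([:1, 1:] * (p + [:50:]) + [:50:]) n)
      (\<lambda>s. frame d m s0 s \<and> s (flag d) 0 = of_bool (fval n k (FEx m \<phi>) e R))"
    proof (rule tc_Seq[OF tc_Assign tc_weaken[OF loop]])
      fix s assume "s = s0"
      then show "Inv 0 (s(flag d := (s (flag d))(aval (Num 0) s := aval (Num 0) s)))"
        by (simp add: Inv_def frame_flag)
    next
      show "1 + 3 + (n + 1) * (poly p n + 30 + 13) \<le> poly ([:1, 1:] * (p + [:50:]) + [:50:]) n"
        by (simp add: algebra_simps)
    qed (use fin n_Inv in \<open>auto simp: Inv_var\<close>)
  qed
  then show ?case by blast
qed

lemma index_inj: "x * n + y = i * n + j \<Longrightarrow> y < n \<Longrightarrow> j < n \<Longrightarrow> x = i \<and> y = (j :: nat)"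
  by (metis add.commute div_mult_self3 div_less mod_mult_self3 mod_less add_0 less_nat_zero_code mod_mult_self1 div_mult_self1)

text \<open>The invariant counts matrix cells in row order, so the end \<open>i * n + n\<close> of
  one row is the start of the next.\<close>

lemma tc_loop2:
  assumes body: "\<And>i j. i < n \<Longrightarrow> j < n \<Longrightarrow>
      tc (\<lambda>s. Inv (i * n + j) s \<and> s (var m) 0 = i \<and> s (var (Suc m)) 0 = j \<and> s ''n'' 0 = n) c B
      (\<lambda>s. Inv (i * n + Suc j) s \<and> s (var m) 0 = i \<and> s (var (Suc m)) 0 = j \<and> s ''n'' 0 = n)"
    and Inv_var: "\<And>c s i f. m \<le> i \<Longrightarrow> Inv c (s(var i := f)) = Inv c s"
  shows "tc (\<lambda>s. Inv 0 s \<and> s ''n'' 0 = n) (loop2 m c) ((n + 1) * ((n + 1) * (B + 13) + 13))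
      (\<lambda>s. Inv (n * n) s \<and> s ''n'' 0 = n)"
proof -
  have inner: "tc (\<lambda>s. (Inv (i * n + 0) s \<and> s (var m) 0 = i) \<and> s ''n'' 0 = n)
      (loop (var (Suc m)) c) ((n + 1) * (B + 13))
      (\<lambda>s. (Inv (i * n + n) s \<and> s (var m) 0 = i) \<and> s ''n'' 0 = n)" if "i < n" for i
    by (rule tc_weaken[OF tc_loop[where Inv = "\<lambda>j s. Inv (i * n + j) s \<and> s (var m) 0 = i"]])
       (auto intro!: tc_weaken[OF body[OF that]] simp: Inv_var)
  show ?thesis unfolding loop2_def
    by (rule tc_weaken[OF tc_loop[where Inv = "\<lambda>i s. Inv (i * n) s"]])
       (auto intro!: tc_weaken[OF inner] simp: Inv_var add.commute)
qed

lemma compile_exists: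
  "scoped_prog p m \<Longrightarrow> \<exists>q. \<forall>n k e R. tc (models n k m e R) (compile p m) (poly q n)
     (models n k m e (run n k p m e R))"
proof (induction p arbitrary: m)
  case (Update t \<phi>)
  then obtain p where p: "\<And>n k. decides n k (poly p n) \<phi> 0 (Suc (Suc m))"
    using decides_exists by fastforce
  define q where "q = [:1, 1:] * ([:1, 1:] * (p + [:40:]) + [:13:]) + [:1, 1:] * ([:1, 1:] * [:40:] + [:13:]) + [:1:]"
  have "tc (models n k m e R) (compile (Update t \<phi>) m) (poly q n)
     (models n k m e (run n k (Update t \<phi>) m e R))" for n k e R
  proof -
    define new where "new = (\<lambda>x y. fval n k \<phi> (e(m := x, Suc m := y)) R)"
    \<comment> \<open>\<open>filled c\<close> and \<open>mixed c\<close> describe the two passes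
      after \<open>c\<close> cells: of \<open>T\<close>, the new values computed so far; of table
      \<open>t\<close>, new values below \<open>c\<close> and old ones from there on.\<close>
    define filled where "filled c s \<longleftrightarrow> (\<forall>x < n. \<forall>y < n. x * n + y < c \<longrightarrow>
      s ''T'' (x * n + y) = of_bool (new x y))" for c and s :: store
    define mixed where "mixed c = R(t := \<lambda>x y. if x * n + y < c then new x y else R t x y)" for c
    have bound: "x * n + y < n * n" if "x < n" "y < n" for x y
    proof -
      have "x * n + y < Suc x * n" using that by simp
      also have "\<dots> \<le> n * n" using that by (intro mult_le_mono1) simp
      finally show ?thesis .
    qed
    have M2: "models n k (Suc (Suc m)) (e(m := i, Suc m := j)) R' s \<longleftrightarrow>
      models n k m e R' s \<and> s (var m) 0 = i \<and> i < n \<and> s (var (Suc m)) 0 = j \<and> j < n" for i j R' s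
      unfolding models_Suc_iff by auto
    have idx: "aval (index m (Suc m)) s = i * n + j"
      if "models n k m e R' s" "s (var m) 0 = i" "s (var (Suc m)) 0 = j" "i < n" for i j R' s
      using that by (auto simp: models_def index_def)
    let ?c1 = "Seq (compile_fm \<phi> 0) (Assign ''T'' (index m (Suc m)) (scalar (flag 0)))"
    let ?c2 = "Assign (tab t) (index m (Suc m)) (Cell ''T'' (index m (Suc m)))"
    have 1: "tc (\<lambda>s. (models n k m e R s \<and> filled 0 s) \<and> s ''n'' 0 = n) (loop2 m ?c1)
      ((n + 1) * ((n + 1) * (poly p n + 20 + 13) + 13))
      (\<lambda>s. (models n k m e R s \<and> filled (n * n) s) \<and> s ''n'' 0 = n)"
    proof (rule tc_loop2[where Inv = "\<lambda>c s. models n k m e R s \<and> filled c s"], rule tc_Seq)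
      fix i j assume ij: "i < n" "j < n"
      let ?Q = "\<lambda>s. (models n k m e R s \<and> filled (i * n + j) s) \<and> s (var m) 0 = i \<and>
        s (var (Suc m)) 0 = j \<and> s (flag 0) 0 = of_bool (new i j)"
      show "tc (\<lambda>s. (models n k m e R s \<and> filled (i * n + j) s) \<and> s (var m) 0 = i \<and>
        s (var (Suc m)) 0 = j \<and> s ''n'' 0 = n) (compile_fm \<phi> 0) (poly p n) ?Q"
      proof (rule tcI)
        fix s assume P: "(models n k m e R s \<and> filled (i * n + j) s) \<and> s (var m) 0 = i \<and>
          s (var (Suc m)) 0 = j \<and> s ''n'' 0 = n"
        then have M: "models n k (Suc (Suc m)) (e(m := i, Suc m := j)) R s" using M2 ij by blast
        then obtain u s' where 1: "exec (compile_fm \<phi> 0) s u s'" "u \<le> poly p n"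
          "frame 0 (Suc (Suc m)) s s'" "s' (flag 0) 0 = of_bool (new i j)"
          using p[unfolded decides_def, rule_format, OF M] unfolding tc_def new_def by blast
        have "s' ''T'' = s ''T''" using 1(3) by (auto simp: frame_def image_iff)
        then have "filled (i * n + j) s'" using P by (simp add: filled_def)
        moreover have "models n k (Suc (Suc m)) (e(m := i, Suc m := j)) R s'"
          using models_frame M 1(3) by blast
        ultimately show "\<exists>u s'. exec (compile_fm \<phi> 0) s u s' \<and> u \<le> poly p n \<and> ?Q s'"
          using 1 M2 by blast
      qed
      show "tc ?Q (Assign ''T'' (index m (Suc m)) (scalar (flag 0))) 15
        (\<lambda>s. (models n k m e R s \<and> filled (i * n + Suc j) s) \<and> s (var m) 0 = i \<and>
          s (var (Suc m)) 0 = j \<and> s ''n'' 0 = n)"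
      proof (rule tc_Assign)
        fix s assume Q: "?Q s"
        let ?s = "s(''T'' := (s ''T'')(aval (index m (Suc m)) s := aval (scalar (flag 0)) s))"
        have "aval (index m (Suc m)) s = i * n + j" using idx Q ij by blast
        then have "filled (i * n + Suc j) ?s"
          using Q ij unfolding filled_def by (auto simp: less_Suc_eq dest: index_inj)
        then show "(models n k m e R ?s \<and> filled (i * n + Suc j) ?s) \<and> ?s (var m) 0 = i \<and>
          ?s (var (Suc m)) 0 = j \<and> ?s ''n'' 0 = n"
          using Q by (simp add: models_update_tmp) (simp add: models_def)
      qed (simp add: index_def)
    qed (auto simp: models_update_var filled_def)
    have 2: "tc (\<lambda>s. (models n k m e (mixed 0) s \<and> filled (n * n) s) \<and> s ''n'' 0 = n) (loop2 m ?c2)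
      ((n + 1) * ((n + 1) * (25 + 13) + 13))
      (\<lambda>s. (models n k m e (mixed (n * n)) s \<and> filled (n * n) s) \<and> s ''n'' 0 = n)"
    proof (rule tc_loop2[where Inv = "\<lambda>c s. models n k m e (mixed c) s \<and> filled (n * n) s"], rule tc_Assign)
      fix i j s assume ij: "i < n" "j < n" and P: "(models n k m e (mixed (i * n + j)) s \<and> filled (n * n) s) \<and>
        s (var m) 0 = i \<and> s (var (Suc m)) 0 = j \<and> s ''n'' 0 = n"
      let ?s = "s(tab t := (s (tab t))(aval (index m (Suc m)) s := aval (Cell ''T'' (index m (Suc m))) s))"
      have a: "aval (index m (Suc m)) s = i * n + j" using idx P ij by blast
      have T: "s ''T'' (i * n + j) = of_bool (new i j)" using P ij bound by (simp add: filled_def)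
      with a have s: "?s = s(tab t := (s (tab t))(i * n + j := of_bool (new i j)))" by simp
      have "0 < ?s (tab t') (x * n + y) \<longleftrightarrow> mixed (i * n + Suc j) t' x y" if "x < n" "y < n" for t' x y
      proof (cases "t' = t")
        case False
        then show ?thesis using P that by (auto simp: models_def mixed_def s)
      next
        case True
        have old: "0 < s (tab t) (x * n + y) \<longleftrightarrow> mixed (i * n + j) t x y"
          using P that by (auto simp: models_def)
        show ?thesis
        proof (cases "x * n + y = i * n + j")
          case eq: True
          then have "x = i" "y = j" using index_inj that ij by blast+
          then show ?thesis using True a T by (simp add: mixed_def)
        next
          case False
          then show ?thesis using True old unfolding s by (auto simp: mixed_def less_Suc_eq)
        qed
      qed
      then have "models n k m e (mixed (i * n + Suc j)) ?s"
        using P unfolding models_def s by auto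
      then show "(models n k m e (mixed (i * n + Suc j)) ?s \<and> filled (n * n) ?s) \<and> ?s (var m) 0 = i \<and>
        ?s (var (Suc m)) 0 = j \<and> ?s ''n'' 0 = n"
        using P by (auto simp: filled_def)
    qed (auto simp: models_update_var filled_def index_def)
    have mixed_0: "mixed 0 = R" by (auto simp: mixed_def)
    have "models n k m e (mixed (n * n)) s \<longleftrightarrow> models n k m e (run n k (Update t \<phi>) m e R) s" for s
      using bound by (auto simp: models_def mixed_def new_def)
    then show ?thesis
      unfolding compile.simps
      by (intro tc_weaken[OF tc_Seq[OF 1 2[unfolded mixed_0] order_refl]])
         (auto simp: filled_def models_def q_def algebra_simps)
  qed
  then show ?case by blast
next
  case (Then p1 p2)
  then obtain q1 q2 where
    q1: "\<And>n k e R. tc (models n k m e R) (compile p1 m) (poly q1 n) (models n k m e (run n k p1 m e R))" and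
    q2: "\<And>n k e R. tc (models n k m e R) (compile p2 m) (poly q2 n) (models n k m e (run n k p2 m e R))"
    by (metis scoped_prog.simps(2))
  have "tc (models n k m e R) (compile (Then p1 p2) m) (poly (q1 + q2 + [:1:]) n)
     (models n k m e (run n k (Then p1 p2) m e R))" for n k e R
    using tc_Seq[OF q1 q2 order_refl] by (simp add: ac_simps)
  then show ?case by blast
next
  case (For p)
  then obtain q where
    q: "\<And>n k e R. tc (models n k (Suc m) e R) (compile p (Suc m)) (poly q n)
      (models n k (Suc m) e (run n k p (Suc m) e R))"
    by (metis scoped_prog.simps(3))
  have "tc (models n k m e R) (compile (For p) m) (poly ([:1, 1:] * (q + [:13:])) n)
     (models n k m e (run n k (For p) m e R))" for n k e R
  proof -
    define Inv where "Inv i = models n k m e (fold (\<lambda>i. run n k p (Suc m) (e(m := i))) [0..<i] R)" for i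
    have Inv_var: "Inv i (s(var m := f)) = Inv i s" for i s f
      by (simp add: Inv_def models_update_var)
    have n_Inv: "s ''n'' 0 = n" if "Inv i s" for i s using that by (simp add: Inv_def models_def)
    have "tc (\<lambda>s. Inv i s \<and> s (var m) 0 = i \<and> s ''n'' 0 = n) (compile p (Suc m)) (poly q n)
      (\<lambda>s. Inv (Suc i) (s(var m := (s (var m))(0 := Suc i))) \<and> s (var m) 0 = i \<and> s ''n'' 0 = n)"
      if "i < n" for i
      by (rule tc_weaken[OF q[of n k "e(m := i)" "fold (\<lambda>i. run n k p (Suc m) (e(m := i))) [0..<i] R"]])
         (use that in \<open>auto simp: Inv_var Inv_def models_Suc_iff models_def[of n k m e]\<close>)
    from tc_loop[OF this] show ?thesis
      unfolding compile.simps
      by (rule tc_weaken) (auto simp: Inv_var Inv_def algebra_simps, auto simp: models_def)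
  qed
  then show ?case by blast
qed

text \<open>Row offsets by repeated addition, starting from \<open>R[0] = 0\<close> in the input
  store.\<close>

definition init :: com where
  "init = loop (var 0) (Assign ''R'' (Plus (scalar (var 0)) (Num 1))
     (Plus (Cell ''R'' (scalar (var 0))) (scalar ''n'')))"

lemma tc_init:
  "tc (\<lambda>s. s = s0 \<and> s ''n'' 0 = n \<and> s ''R'' 0 = 0) init ((n + 1) * 33)
     (\<lambda>s. (\<forall>x. x \<noteq> ''R'' \<longrightarrow> x \<noteq> var 0 \<longrightarrow> s x = s0 x) \<and> (\<forall>i < n. s ''R'' i = i * n))"
proof -
  define Inv where "Inv i s \<longleftrightarrow> (\<forall>x. x \<noteq> ''R'' \<longrightarrow> x \<noteq> var 0 \<longrightarrow> s x = s0 x) \<and>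
    (\<forall>j \<le> i. s ''R'' j = j * n)" for i and s :: store
  have "tc (\<lambda>s. Inv i s \<and> s (var 0) 0 = i \<and> s ''n'' 0 = n)
    (Assign ''R'' (Plus (scalar (var 0)) (Num 1)) (Plus (Cell ''R'' (scalar (var 0))) (scalar ''n''))) 20
    (\<lambda>s. Inv (Suc i) (s(var 0 := (s (var 0))(0 := Suc i))) \<and> s (var 0) 0 = i \<and> s ''n'' 0 = n)" for i
    by (rule tc_Assign) (auto simp: Inv_def le_Suc_eq)
  from tc_loop[OF this] show ?thesis
    unfolding init_def by (rule tc_weaken) (auto simp: Inv_def)
qed

lemma poly_nat_mono: "x \<le> y \<Longrightarrow> poly p x \<le> poly (p :: nat poly) y"
  by (induction p) (auto intro: add_mono mult_mono)

text \<open>The interface between logic and machine. The bound depends on \<open>n\<close> alone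
  because \<open>k\<close> enters only through comparisons.\<close>

theorem polytime_definable:
  assumes "scoped_prog p 0" "scoped \<phi> 0"
  shows "\<exists>c q. \<forall>s R. (\<forall>x y. x < s ''n'' 0 \<longrightarrow> y < s ''n'' 0 \<longrightarrow>
         (0 < s ''A'' (x * s ''n'' 0 + y) \<longleftrightarrow> R x y)) \<longrightarrow>
       s ''R'' = (\<lambda>i. 0) \<longrightarrow> (\<forall>t > 0. s (tab t) = (\<lambda>i. 0)) \<longrightarrow>
       (\<exists>t s'. exec c s t s' \<and> t \<le> poly q (s ''n'' 0) \<and>
         s' ''out'' 0 = of_bool (fval (s ''n'' 0) (s ''k'' 0) \<phi> (\<lambda>_. 0)
           (run (s ''n'' 0) (s ''k'' 0) p 0 (\<lambda>_. 0) ((\<lambda>t x y. False)(0 := R)))))"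
proof -
  obtain q1 where q1: "\<And>n k e R. tc (models n k 0 e R) (compile p 0) (poly q1 n) (models n k 0 e (run n k p 0 e R))"
    using compile_exists[OF assms(1)] by blast
  obtain q2 where q2: "\<And>n k. decides n k (poly q2 n) \<phi> 0 0"
    using decides_exists[OF assms(2)] by blast
  define c where "c = Seq init (Seq (compile p 0) (Seq (compile_fm \<phi> 0)
    (Assign ''out'' (Num 0) (scalar (flag 0)))))"
  define q where "q = [:33, 33:] + q1 + q2 + [:20:]"
  show ?thesis
  proof (intro exI[of _ c] exI[of _ q] allI impI)
    fix s0 :: store and R
    define n k where "n = s0 ''n'' 0" and "k = s0 ''k'' 0"
    assume A: "\<forall>x y. x < s0 ''n'' 0 \<longrightarrow> y < s0 ''n'' 0 \<longrightarrow>
         (0 < s0 ''A'' (x * s0 ''n'' 0 + y) \<longleftrightarrow> R x y)"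
      and R0: "s0 ''R'' = (\<lambda>i. 0)" and T0: "\<forall>t > 0. s0 (tab t) = (\<lambda>i. 0)"
    let ?R0 = "(\<lambda>t x y. False)(0 := R)" and ?e = "\<lambda>_ :: nat. 0 :: nat"
    let ?R1 = "run n k p 0 ?e ?R0"
    have 1: "tc (\<lambda>s. s = s0) init ((n + 1) * 33) (models n k 0 ?e ?R0)"
    proof (rule tc_weaken[OF tc_init[of s0 n]])
      fix s :: store
      assume s: "(\<forall>x. x \<noteq> ''R'' \<longrightarrow> x \<noteq> var 0 \<longrightarrow> s x = s0 x) \<and> (\<forall>i < n. s ''R'' i = i * n)"
      then have "s (tab t) = s0 (tab t)" for t by simp
      moreover have "0 < s0 (tab t) (x * n + y) \<longleftrightarrow> ?R0 t x y" if "x < n" "y < n" for t x y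
        using A T0 that by (cases "t = 0") (auto simp: n_def tab_0)
      ultimately show "models n k 0 ?e ?R0 s" using s by (auto simp: models_def n_def k_def)
    qed (use R0 n_def in auto)
    have 2: "tc (models n k 0 ?e ?R1) (compile_fm \<phi> 0) (poly q2 n)
      (\<lambda>s. s (flag 0) 0 = of_bool (fval n k \<phi> ?e ?R1))"
      using q2[of n k] unfolding decides_def tc_def by fastforce
    have 3: "tc (\<lambda>s. s (flag 0) 0 = of_bool (fval n k \<phi> ?e ?R1)) (Assign ''out'' (Num 0) (scalar (flag 0))) 10
      (\<lambda>s. s ''out'' 0 = of_bool (fval n k \<phi> ?e ?R1))"
      by (rule tc_Assign) auto
    have "tc (\<lambda>s. s = s0) c (poly q n) (\<lambda>s. s ''out'' 0 = of_bool (fval n k \<phi> ?e ?R1))"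
      unfolding c_def
      by (rule tc_Seq[OF 1 tc_Seq[OF q1 tc_Seq[OF 2 3 order_refl] order_refl]]) (simp add: q_def)
    then show "\<exists>t s'. exec c s0 t s' \<and> t \<le> poly q (s0 ''n'' 0) \<and>
         s' ''out'' 0 = of_bool (fval (s0 ''n'' 0) (s0 ''k'' 0) \<phi> (\<lambda>_. 0)
           (run (s0 ''n'' 0) (s0 ''k'' 0) p 0 (\<lambda>_. 0) ((\<lambda>t x y. False)(0 := R))))"
      unfolding tc_def n_def k_def by blast
  qed
qed

section \<open>The decision procedure\<close>

abbreviation "FOr \<phi> \<psi> \<equiv> FNot (FAnd (FNot \<phi>) (FNot \<psi>))"
abbreviation "FImp \<phi> \<psi> \<equiv> FNot (FAnd \<phi> (FNot \<psi>))"
abbreviation "FAll x \<phi> \<equiv> FNot (FEx x (FNot \<phi>))"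

text \<open>
  Table 0 is the adjacency matrix, 1 the orientation (\<open>r x < l y\<close>), 2 the order of right ends
  (\<open>r x < r y\<close>). After \<open>j\<close> rounds, row \<open>x\<close> of tables 3 and 4 holds \<open>far j\<close> and \<open>joined j\<close> for the
  vertices to the right of \<open>x\<close>, and table 5 the candidates there; table 6 is used for the
  candidates of the whole graph.
\<close>

definition seed_fm :: fm where
  "seed_fm = FOr (FRel 1 2 3) (FAnd (FEq 2 0) (FAnd (FEq 3 1)
     (FAnd (FNot (FEq 2 3)) (FAnd (FNot (FRel 0 2 3)) (FNot (FRel 1 3 2))))))"

definition closure_fm :: fm where
  "closure_fm = FOr (FRel 1 4 5) (FAnd (FNot (FEq 4 5)) (FAnd (FNot (FRel 0 4 5))
     (FEx 6 (FOr (FAnd (FRel 1 6 5) (FRel 0 6 4)) (FAnd (FRel 1 4 6) (FRel 0 6 5))))))"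

text \<open>The two inner loops merely repeat the closure step \<open>n * n\<close> times, as
  \<open>closure_iterate\<close> asks; their counters are variables 2 and 3, so the update uses 4
  and 5.\<close>

definition orient_prog :: prog where
  "orient_prog = For (For (Then (Update 1 seed_fm) (For (For (Update 1 closure_fm)))))"

definition rless_fm :: fm where
  "rless_fm = FEx 2 (FAnd (FRel 1 0 2) (FNot (FRel 1 1 2)))"

text \<open>\<open>S v\<close> together with \<open>FRel 3 y v\<close> says that \<open>v\<close> is
  in \<open>win\<close>. Row \<open>y\<close> of table 3 serves every ground set in question, by
  \<open>after_after\<close>. Variables \<open>d\<close> and \<open>Suc d\<close> are the
  \<open>u\<close> and \<open>w\<close> of \<open>cand\<close>.\<close>

definition cand_fm :: "(nat \<Rightarrow> fm) \<Rightarrow> nat \<Rightarrow> nat \<Rightarrow> fm" where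
  "cand_fm S y d = FAnd (S y) (FAnd (FRel 3 y y) (FNot (FEx d (FEx (Suc d)
     (FAnd (FAnd (S d) (FRel 3 y d)) (FAnd (FAnd (S (Suc d)) (FRel 3 y (Suc d)))
       (FAnd (FNot (FRel 1 (Suc d) d)) (FAnd (FRel 2 (Suc d) y) (FNot (FRel 2 d y))))))))))"

text \<open>Variable 1 names the ground set (the vertices right of it); 3, 4, 5, 6 are the
  \<open>y\<close>, \<open>u\<close>, \<open>w\<close>, \<open>z\<close> of
  \<open>swept\<close>.\<close>

definition swept_fm :: fm where
  "swept_fm = (let W = (\<lambda>v. FAnd (FRel 1 1 v) (FRel 3 3 v)) in
     FAnd (W 4) (FAnd (FNot (FRel 2 4 3))
       (FAll 5 (FImp (FAnd (W 5) (FAnd (FNot (FRel 2 5 3)) (FRel 1 5 4)))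
         (FEx 6 (FAnd (W 6) (FAnd (FNot (FRel 1 5 6)) (FRel 2 5 6))))))))"

definition far_fm :: fm where
  "far_fm = FAnd (FEx 3 (FRel 5 1 3))
     (FAll 3 (FImp (FRel 5 1 3) (FEx 4 (FAnd swept_fm (FRel 1 2 4)))))"

definition joined_fm :: "(nat \<Rightarrow> fm) \<Rightarrow> nat \<Rightarrow> fm" where
  "joined_fm C y = FEx y (FAnd (C y) (FAnd (FRel 4 y y)
     (FAll (Suc y) (FImp (C (Suc y)) (FAnd (FNot (FRel 2 y (Suc y))) (FNot (FRel 2 (Suc y) y)))))))"

text \<open>Makes exactly the first \<open>k - 1\<close> of the \<open>n\<close> rounds effective.\<close>

definition guard_fm :: "fm \<Rightarrow> fm \<Rightarrow> fm" where
  "guard_fm \<phi> \<psi> = FOr (FAnd (FSucK 0) \<phi>) (FAnd (FNot (FSucK 0)) \<psi>)"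

text \<open>The order matters: candidates and swept places refer to the old number of tokens, so
  table 3 is replaced last, after table 5 has been computed from it.\<close>

definition round_prog :: prog where
  "round_prog = Then (Update 5 (cand_fm (FRel 1 1) 2 3))
     (Then (Update 4 (guard_fm (joined_fm (FRel 5 1) 3) (FRel 4 1 2)))
        (Update 3 (guard_fm far_fm (FRel 3 1 2))))"

definition main_prog :: prog where
  "main_prog = Then orient_prog (Then (Update 2 rless_fm) (Then (Update 3 (FEq 0 0))
     (Then (Update 4 (FEq 0 0)) (Then (For round_prog)
        (Update 6 (cand_fm (\<lambda>v. FEq v v) 1 2))))))"

definition answer_fm :: fm where
  "answer_fm = FOr (FNot FPosK) (joined_fm (\<lambda>y. FRel 6 y y) 0)"

lemmas fm_defs = seed_fm_def closure_fm_def rless_fm_def cand_fm_def swept_fm_def Let_def far_fm_def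
  joined_fm_def guard_fm_def answer_fm_def

lemma scoped_main: "scoped_prog main_prog 0" "scoped answer_fm 0"
  by (simp_all add: main_prog_def orient_prog_def round_prog_def fm_defs)

section \<open>Correctness of the orientation program\<close>

lemma fold_const: "fold (\<lambda>_. f) xs = f ^^ length xs"
  by (induction xs) (simp_all add: funpow_swap1 fun_eq_iff)

lemma fold_upt_induct:
  assumes "P 0 x" "\<And>i x. i < n \<Longrightarrow> P i x \<Longrightarrow> P (Suc i) (f i x)"
  shows "P n (fold f [0..<n] x)"
proof -
  have "i \<le> n \<Longrightarrow> P i (fold f [0..<i] x)" for i
    by (induction i) (use assms in auto)
  then show ?thesis by simp
qed

lemma run_For: "run n k (For p) m e = fold (\<lambda>i. run n k p (Suc m) (e(m := i))) [0..<n]"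
  by (rule ext) simp

definition pairs :: "(nat \<Rightarrow> nat \<Rightarrow> bool) \<Rightarrow> (nat \<times> nat) set" where
  "pairs f = {(x, y). f x y}"

context cocomparability
begin

lemma oriented_antimono: "oriented Q D \<Longrightarrow> Q' \<inter> non \<subseteq> Q \<Longrightarrow> oriented Q' D"
  unfolding oriented_def by (elim conjE, intro conjI) (assumption | blast)+

lemma run_closure:
  assumes "R 0 = A"
  shows "run n k (For (For (Update 1 closure_fm))) 2 e R 0 = A"
    "pairs (run n k (For (For (Update 1 closure_fm))) 2 e R 1) = (closure_step ^^ (n * n)) (pairs (R 1))"
proof -
  define U where "U R = R(1 := \<lambda>x y. fval n k closure_fm ((\<lambda>_. 0)(4 := x, 5 := y)) R)"
    for R :: "nat \<Rightarrow> nat \<Rightarrow> nat \<Rightarrow> bool"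
  have "run n k (Update 1 closure_fm) 4 e = U" for e
    by (simp add: fun_eq_iff U_def fm_defs)
  then have eq: "run n k (For (For (Update 1 closure_fm))) 2 e R = (U ^^ (n * n)) R"
    by (simp add: run_For fold_const funpow_mult numeral_eq_Suc del: run.simps)
  have "(U ^^ t) R 0 = A \<and> pairs ((U ^^ t) R 1) = (closure_step ^^ t) (pairs (R 1))" for t
  proof (induction t)
    case (Suc t)
    have "pairs (U R' 1) = closure_step (pairs (R' 1))" if "R' 0 = A" for R'
      using that by (auto simp: pairs_def U_def fm_defs closure_step_def)
    then show ?case using Suc by (simp add: U_def)
  qed (use assms in simp)
  then show "run n k (For (For (Update 1 closure_fm))) 2 e R 0 = A"
    "pairs (run n k (For (For (Update 1 closure_fm))) 2 e R 1) = (closure_step ^^ (n * n)) (pairs (R 1))"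
    unfolding eq by auto
qed

lemma run_orient:
  assumes "R 0 = A" "\<And>x y. \<not> R 1 x y"
  shows "run n k orient_prog 0 e R 0 = A"
    "oriented ({..<n} \<times> {..<n}) (pairs (run n k orient_prog 0 e R 1))"
proof -
  define P where "P i j R \<longleftrightarrow> R 0 = A \<and> oriented {q. \<not> lexle (i, j) q} (pairs (R 1))"
    for i j and R :: "nat \<Rightarrow> nat \<Rightarrow> nat \<Rightarrow> bool"
  let ?body = "Then (Update 1 seed_fm) (For (For (Update 1 closure_fm)))"
  have body: "P i (Suc j) (run n k ?body 2 (e(0 := i, 1 := j)) R)" if P: "P i j R" and ij: "i < n" "j < n" for i j e R
  proof -
    let ?R = "run n k (Update 1 seed_fm) 2 (e(0 := i, 1 := j)) R"
    have R0: "?R 0 = A" using P by (simp add: P_def)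
    have "pairs (?R 1) = pairs (R 1) \<union> (if (i, j) \<in> non \<and> (j, i) \<notin> pairs (R 1) then {(i, j)} else {})"
      using P ij by (auto simp: pairs_def P_def non_def fm_defs)
    then have "oriented (insert (i, j) {q. \<not> lexle (i, j) q}) ((closure_step ^^ (n * n)) (pairs (?R 1)))"
      using oriented_step[of i j "pairs (R 1)"] P by (simp add: P_def)
    moreover have "insert (i, j) {q. \<not> lexle (i, j) q} = {q. \<not> lexle (i, Suc j) q}"
      by (auto simp: lexle_def)
    ultimately show ?thesis
      using run_closure[of ?R, OF R0] by (simp add: P_def)
  qed
  have "P (Suc i) 0 (run n k (For ?body) 1 (e(0 := i)) R)" if "P i 0 R" "i < n" for i e R
  proof -
    have "P i n (fold (\<lambda>j. run n k ?body 2 (e(0 := i, 1 := j))) [0..<n] R)"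
      by (rule fold_upt_induct[where P = "P i"]) (use that body in auto)
    then have "P i n (run n k (For ?body) 1 (e(0 := i)) R)" by (simp add: numeral_eq_Suc)
    then have R': "run n k (For ?body) 1 (e(0 := i)) R 0 = A"
      "oriented {q. \<not> lexle (i, n) q} (pairs (run n k (For ?body) 1 (e(0 := i)) R 1))"
      by (simp_all only: P_def)
    \<comment> \<open>Entries of pairs in \<open>non\<close> are below \<open>n\<close>, so
      completing row \<open>i\<close> is the same as standing at the start of row
      \<open>Suc i\<close>.\<close>
    have "{q. \<not> lexle (Suc i, 0) q} \<inter> non \<subseteq> {q. \<not> lexle (i, n) q}"
      by (auto simp: lexle_def non_def)
    from oriented_antimono[OF R'(2) this] R'(1) show ?thesis unfolding P_def by blast
  qed
  moreover have "P 0 0 R"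
  proof -
    have R1: "pairs (R 1) = {}" and "{q. \<not> lexle (0, 0) q} = {}"
      using assms(2) by (auto simp: pairs_def lexle_def)
    then show ?thesis unfolding P_def R1 using assms(1) oriented_empty by metis
  qed
  ultimately have "P n 0 (fold (\<lambda>i. run n k (For ?body) 1 (e(0 := i))) [0..<n] R)"
    by (intro fold_upt_induct[where P = "\<lambda>i. P i 0"])
  then have "P n 0 (run n k orient_prog 0 e R)" by (simp add: orient_prog_def)
  then have fin: "run n k orient_prog 0 e R 0 = A"
    "oriented {q. \<not> lexle (n, 0) q} (pairs (run n k orient_prog 0 e R 1))"
    by (simp_all only: P_def)
  show "run n k orient_prog 0 e R 0 = A" by (fact fin(1))
  have "({..<n} \<times> {..<n}) \<inter> non \<subseteq> {q. \<not> lexle (n, 0) q}" by (auto simp: lexle_def)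
  from oriented_antimono[OF fin(2) this]
  show "oriented ({..<n} \<times> {..<n}) (pairs (run n k orient_prog 0 e R 1))" .
qed

end

text \<open>Hence the recursion meets only the whole vertex set and the sets to the right of one
  vertex, and tables with one row per vertex suffice.\<close>

lemma (in interval_family) after_after:
  "S \<subseteq> V \<Longrightarrow> y \<in> after S x \<Longrightarrow> after (after S x) y = after S y"
  using l_le_r[of y] by (auto simp: after_def)

section \<open>Correctness of the rounds\<close>

locale numbered_intervals = interval_family "{..<n}" l r for n :: nat and l r :: "nat \<Rightarrow> nat"
begin

abbreviation right :: "nat \<Rightarrow> nat set" where "right \<equiv> after {..<n}"

definition tables :: "nat \<Rightarrow> (nat \<Rightarrow> nat \<Rightarrow> nat \<Rightarrow> bool) \<Rightarrow> bool" where
  "tables j R \<longleftrightarrow> (\<forall>x < n. \<forall>y < n. (R 1 x y \<longleftrightarrow> r x < l y) \<and> (R 2 x y \<longleftrightarrow> r x < r y) \<and>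
     (R 3 x y \<longleftrightarrow> far j (right x) y) \<and> (R 4 x y \<longleftrightarrow> joined j (right x)))"

lemma win_tables:
  assumes "tables j R" "S \<subseteq> {..<n}" "after S y = right y" "y < n"
  shows "v \<in> win j S y \<longleftrightarrow> v < n \<and> v \<in> S \<and> R 3 y v"
  using assms by (auto simp: win_def tables_def)

text \<open>The hypothesis on \<open>after S y\<close> covers both uses: \<open>S = right x\<close>,
  where \<open>after_after\<close> provides it, and the whole vertex set, where it is
  trivial.\<close>

lemma cand_tables:
  assumes "tables j R" "S \<subseteq> {..<n}" "y \<in> S \<longrightarrow> after S y = right y" "y < n"
  shows "cand j S y \<longleftrightarrow> y \<in> S \<and> R 3 y y \<and> \<not> (\<exists>u < n. \<exists>w < n. (u \<in> S \<and> R 3 y u) \<and>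
     (w \<in> S \<and> R 3 y w) \<and> \<not> R 1 w u \<and> R 2 w y \<and> \<not> R 2 u y)"
proof (cases "y \<in> S")
  case True
  have t: "R 1 u w \<longleftrightarrow> r u < l w" "R 2 u w \<longleftrightarrow> r u < r w" if "u < n" "w < n" for u w
    using assms(1) that by (auto simp: tables_def)
  note win = win_tables[OF assms(1,2) assms(3)[rule_format, OF True] assms(4)]
  have "cand j S y \<longleftrightarrow> y \<in> S \<and> R 3 y y \<and> \<not> (\<exists>u w. u \<in> win j S y \<and> w \<in> win j S y \<and>
      l u \<le> r w \<and> r w < r y \<and> r y \<le> r u)"
    unfolding cand_def using True assms(4) win[of y] by blast
  also have "(\<exists>u w. u \<in> win j S y \<and> w \<in> win j S y \<and> l u \<le> r w \<and> r w < r y \<and> r y \<le> r u) \<longleftrightarrow>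
      (\<exists>u < n. \<exists>w < n. (u \<in> S \<and> R 3 y u) \<and> (w \<in> S \<and> R 3 y w) \<and> \<not> R 1 w u \<and> R 2 w y \<and> \<not> R 2 u y)"
  proof -
    have "l u \<le> r w \<and> r w < r y \<and> r y \<le> r u \<longleftrightarrow> \<not> R 1 w u \<and> R 2 w y \<and> \<not> R 2 u y"
      if "u < n" "w < n" for u w
      using t that assms(4) by (simp add: not_less)
    then have "u \<in> win j S y \<and> w \<in> win j S y \<and> l u \<le> r w \<and> r w < r y \<and> r y \<le> r u \<longleftrightarrow>
        u < n \<and> w < n \<and> (u \<in> S \<and> R 3 y u) \<and> (w \<in> S \<and> R 3 y w) \<and> \<not> R 1 w u \<and> R 2 w y \<and> \<not> R 2 u y" for u w
      unfolding win by blast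
    then show ?thesis by blast
  qed
  finally show ?thesis .
qed (simp add: cand_def win_def)

lemma swept_tables:
  assumes "tables j R" "S \<subseteq> {..<n}" "after S y = right y" "y < n" "u < n"
  shows "swept j S y u \<longleftrightarrow> (u \<in> S \<and> R 3 y u) \<and> \<not> R 2 u y \<and>
     (\<forall>w < n. (w \<in> S \<and> R 3 y w) \<and> \<not> R 2 w y \<and> R 1 w u \<longrightarrow>
        (\<exists>z < n. (z \<in> S \<and> R 3 y z) \<and> \<not> R 1 w z \<and> R 2 w z))"
proof -
  have t: "R 1 u w \<longleftrightarrow> r u < l w" "R 2 u w \<longleftrightarrow> r u < r w" if "u < n" "w < n" for u w
    using assms(1) that by (auto simp: tables_def)
  note win = win_tables[OF assms(1-4)]
  have z: "(\<exists>z \<in> win j S y. l z \<le> r w \<and> r w < r z) \<longleftrightarrow>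
      (\<exists>z < n. (z \<in> S \<and> R 3 y z) \<and> \<not> R 1 w z \<and> R 2 w z)" if "w < n" for w
  proof -
    have "z \<in> win j S y \<and> l z \<le> r w \<and> r w < r z \<longleftrightarrow>
        z < n \<and> (z \<in> S \<and> R 3 y z) \<and> \<not> R 1 w z \<and> R 2 w z" for z
      unfolding win using t[OF that, of z] by (auto simp: not_less simp del: One_nat_def)
    then show ?thesis unfolding Bex_def by blast
  qed
  have "(w \<in> win j S y \<longrightarrow> r y \<le> r w \<and> r w < l u \<longrightarrow> (\<exists>z \<in> win j S y. l z \<le> r w \<and> r w < r z)) \<longleftrightarrow>
     (w < n \<longrightarrow> (w \<in> S \<and> R 3 y w) \<and> \<not> R 2 w y \<and> R 1 w u \<longrightarrow>
        (\<exists>z < n. (z \<in> S \<and> R 3 y z) \<and> \<not> R 1 w z \<and> R 2 w z))" for w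
  proof (cases "w < n")
    case True
    show ?thesis using True assms(4,5) unfolding z[OF True] win
      by (auto simp: t not_less simp del: One_nat_def)
  qed (simp add: win)
  then show ?thesis
    unfolding swept_def Ball_def win[of u] using t[OF assms(5,4)] assms(5) by (simp only: not_less) blast
qed

lemma run_round:
  assumes T: "tables j R"
  shows "tables (if Suc i < k then Suc j else j) (run n k round_prog 1 (e(0 := i)) R)"
proof -
  have R: "R 1 x y \<longleftrightarrow> r x < l y" "R 2 x y \<longleftrightarrow> r x < r y" "R 3 x y \<longleftrightarrow> far j (right x) y"
    "R 4 x y \<longleftrightarrow> joined j (right x)" if "x < n" "y < n" for x y
    using T that by (auto simp: tables_def)
  have mem: "v \<in> right x \<longleftrightarrow> R 1 x v" if "v < n" "x < n" for v x
    using that R(1) by (auto simp: after_def)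
  have sub: "right x \<subseteq> {..<n}" for x by (auto simp: after_def)
  have aa: "y \<in> right x \<longrightarrow> after (right x) y = right y" for x y
    using after_after[of "{..<n}" y x] by simp
  \<comment> \<open>\<open>C\<close>, and below \<open>J\<close>, \<open>Sw\<close> and
    \<open>F\<close>, spell out the queries over the tables; they mediate between the recursions on
    one side and the formulas on the other.\<close>
  define C where "C x y \<longleftrightarrow> R 1 x y \<and> R 3 y y \<and> \<not> (\<exists>u < n. \<exists>w < n. (R 1 x u \<and> R 3 y u) \<and>
     (R 1 x w \<and> R 3 y w) \<and> \<not> R 1 w u \<and> R 2 w y \<and> \<not> R 2 u y)" for x y
  have C: "C x y \<longleftrightarrow> cand j (right x) y" if "x < n" "y < n" for x y
    unfolding cand_tables[OF T sub aa that(2)] C_def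
    using mem that by (simp cong: conj_cong)
  have candD: "y < n \<and> R 1 x y" if "cand j (right x) y" "x < n" for x y
    using that R(1) by (auto simp: cand_def win_def after_def)
  define J where "J x \<longleftrightarrow> (\<exists>y < n. C x y \<and> R 4 y y \<and>
     (\<forall>z < n. C x z \<longrightarrow> \<not> R 2 y z \<and> \<not> R 2 z y))" for x
  have J: "J x \<longleftrightarrow> joined (Suc j) (right x)" if x: "x < n" for x
  proof -
    have "joined (Suc j) (right x) \<longleftrightarrow> (\<exists>y < n. cand j (right x) y \<and> joined j (right y) \<and>
       (\<forall>z < n. cand j (right x) z \<longrightarrow> r y = r z))"
      unfolding joined_Suc[OF sub] using candD[OF _ x] aa mem x by metis
    also have "\<dots> \<longleftrightarrow> J x"
    proof -
      have "r y = r z \<longleftrightarrow> \<not> R 2 y z \<and> \<not> R 2 z y" if "y < n" "z < n" for y z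
        using R(2) that by auto
      then show ?thesis unfolding J_def using C[OF x] R(4) by metis
    qed
    finally show ?thesis by simp
  qed
  define Sw where "Sw x y u \<longleftrightarrow> (R 1 x u \<and> R 3 y u) \<and> \<not> R 2 u y \<and>
     (\<forall>w < n. (R 1 x w \<and> R 3 y w) \<and> \<not> R 2 w y \<and> R 1 w u \<longrightarrow>
        (\<exists>z < n. (R 1 x z \<and> R 3 y z) \<and> \<not> R 1 w z \<and> R 2 w z))" for x y u
  define F where "F x v \<longleftrightarrow> (\<exists>y < n. C x y) \<and>
     (\<forall>y < n. C x y \<longrightarrow> (\<exists>u < n. Sw x y u \<and> R 1 v u))" for x v
  have F: "F x v \<longleftrightarrow> far (Suc j) (right x) v" if x: "x < n" "v < n" for x v
  proof -
    have sw: "swept j (right x) y u \<longleftrightarrow> u < n \<and> Sw x y u" if "y < n" "C x y" for y u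
    proof (cases "u < n")
      case True
      have "y \<in> right x" using that mem x by (simp add: C_def)
      then show ?thesis
        unfolding swept_tables[OF T sub aa[rule_format, OF \<open>y \<in> right x\<close>] that(1) True] Sw_def
        using mem x that True by (simp cong: conj_cong)
    qed (auto simp: swept_def win_def after_def)
    have "cand j (right x) y \<longleftrightarrow> y < n \<and> C x y" for y using candD[of x y] C x(1) by blast
    then have "far (Suc j) (right x) v \<longleftrightarrow> (\<exists>y < n. C x y) \<and>
      (\<forall>y < n. C x y \<longrightarrow> (\<exists>u. swept j (right x) y u \<and> r v < l u))"
      unfolding far_Suc[OF sub] by blast
    also have "\<dots> \<longleftrightarrow> F x v"
    proof -
      have "(\<exists>u. swept j (right x) y u \<and> r v < l u) \<longleftrightarrow> (\<exists>u < n. Sw x y u \<and> R 1 v u)"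
        if "y < n" "C x y" for y
        using sw[OF that] R(1)[OF x(2)] by blast
      then show ?thesis unfolding F_def by blast
    qed
    finally show ?thesis by simp
  qed
  let ?R = "run n k round_prog 1 (e(0 := i)) R"
  have "fval n k (cand_fm (FRel 1 1) 2 3) (e(0 := i, 1 := x, 2 := y)) R \<longleftrightarrow> C x y" for x y
    unfolding C_def cand_fm_def by simp
  then have "run n k (Update 5 (cand_fm (FRel 1 1) 2 3)) 1 (e(0 := i)) R = R(5 := C)"
    by (simp add: fun_eq_iff numeral_2_eq_2)
  then have R': "?R = run n k (Then (Update 4 (guard_fm (joined_fm (FRel 5 1) 3) (FRel 4 1 2)))
      (Update 3 (guard_fm far_fm (FRel 3 1 2)))) 1 (e(0 := i)) (R(5 := C))"
    by (simp add: round_prog_def)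
  have "?R 1 = R 1" "?R 2 = R 2" unfolding R' by simp_all
  moreover have "?R 4 x y \<longleftrightarrow> (if Suc i < k then J x else R 4 x y)" for x y
    unfolding R' J_def by (cases "Suc i < k") (auto simp: guard_fm_def joined_fm_def)
  moreover have "?R 3 x y \<longleftrightarrow> (if Suc i < k then F x y else R 3 x y)" for x y
  proof -
    define Q where "Q = run n k (Update 4 (guard_fm (joined_fm (FRel 5 1) 3) (FRel 4 1 2))) 1 (e(0 := i)) (R(5 := C))"
    have Q: "Q 1 = R 1" "Q 2 = R 2" "Q 3 = R 3" "Q 5 = C" by (simp_all add: Q_def)
    have sw: "fval n k swept_fm e' Q \<longleftrightarrow> Sw (e' 1) (e' 3) (e' 4)"
      if "Q 1 = R 1" "Q 2 = R 2" "Q 3 = R 3" for e' Q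
      unfolding Sw_def swept_fm_def Let_def using that by simp blast
    have far: "fval n k far_fm e' Q \<longleftrightarrow> F (e' 1) (e' 2)"
      if "Q 1 = R 1" "Q 2 = R 2" "Q 3 = R 3" "Q 5 = C" for e' Q
      unfolding F_def far_fm_def fval.simps sw[OF that(1-3)] using that by simp blast
    have "?R 3 x y \<longleftrightarrow> fval n k (guard_fm far_fm (FRel 3 1 2)) (e(0 := i, 1 := x, 2 := y)) Q"
      unfolding R' run.simps(2) Q_def[symmetric] by (simp add: numeral_2_eq_2)
    also have "\<dots> \<longleftrightarrow> (if Suc i < k then F x y else R 3 x y)"
      unfolding guard_fm_def fval.simps far[OF Q] Q by simp
    finally show ?thesis .
  qed
  ultimately have "(?R 1 x y \<longleftrightarrow> r x < l y) \<and> (?R 2 x y \<longleftrightarrow> r x < r y) \<and>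
     (?R 3 x y \<longleftrightarrow> far (if Suc i < k then Suc j else j) (right x) y) \<and>
     (?R 4 x y \<longleftrightarrow> joined (if Suc i < k then Suc j else j) (right x))" if "x < n" "y < n" for x y
    using R[OF that] J[OF that(1)] F[OF that] by simp
  then show ?thesis unfolding tables_def by (intro allI impI)
qed

lemma run_rounds:
  assumes "tables 0 R"
  shows "tables (min n (k - 1)) (run n k (For round_prog) 0 e R)"
  unfolding run.simps
proof (rule fold_upt_induct[where P = "\<lambda>i. tables (min i (k - 1))"])
  fix i R assume "tables (min i (k - 1)) R"
  moreover have "(if Suc i < k then Suc (min i (k - 1)) else min i (k - 1)) = min (Suc i) (k - 1)"
    by auto
  ultimately show "tables (min (Suc i) (k - 1)) (run n k round_prog (Suc 0) (e(0 := i)) R)"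
    using run_round[of "min i (k - 1)" R i k e] by simp
qed (use assms in simp)

text \<open>\<open>rest\<close> is what follows the orientation, so the orientation enters only
  through hypotheses on the table \<open>R 1\<close> that it leaves behind.\<close>

lemma run_main:
  assumes "\<And>x y. x < n \<Longrightarrow> y < n \<Longrightarrow> R 1 x y \<longleftrightarrow> r x < l y"
    and "\<And>x y. x < n \<Longrightarrow> y < n \<Longrightarrow> r x < r y \<longleftrightarrow> (\<exists>z < n. R 1 x z \<and> \<not> R 1 y z)"
    and main: "main_prog = Then orient_prog rest"
  shows "fval n k answer_fm e (run n k rest 0 e R) \<longleftrightarrow> joined k {..<n}"
proof (cases "k = 0")
  case True
  then show ?thesis by (simp add: answer_fm_def joined_0)
next
  case False
  define j where "j = min n (k - 1)"
  define R0 where "R0 = run n k (Then (Update 2 rless_fm) (Then (Update 3 (FEq 0 0)) (Update 4 (FEq 0 0)))) 0 e R"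
  have R0_simps: "R0 1 = R 1" "R0 2 x y \<longleftrightarrow> (\<exists>z < n. R 1 x z \<and> \<not> R 1 y z)" "R0 3 x y" "R0 4 x y" for x y
    by (simp_all add: R0_def rless_fm_def)
  then have "tables 0 R0"
    using assms(1,2) by (auto simp: tables_def far_0 joined_0)
  define R1 where "R1 = run n k (For round_prog) 0 e R0"
  have T: "tables j R1" unfolding R1_def j_def by (rule run_rounds) fact
  then have t: "R1 2 x y \<longleftrightarrow> r x < r y" "R1 4 x y \<longleftrightarrow> joined j (right x)" if "x < n" "y < n" for x y
    using that by (auto simp: tables_def)
  define R2 where "R2 = run n k (Update 6 (cand_fm (\<lambda>v. FEq v v) 1 2)) 0 e R1"
  have run: "run n k rest 0 e R = R2"
    using main unfolding main_prog_def R2_def R1_def R0_def by (auto simp del: One_nat_def)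
  have old: "R2 2 = R1 2" "R2 4 = R1 4" by (simp_all add: R2_def)
  have C: "R2 6 x y \<longleftrightarrow> cand j {..<n} y" if "y < n" for x y
    unfolding cand_tables[OF T order_refl impI[OF refl] that] using that
    by (simp add: R2_def cand_fm_def) blast
  have "cand j {..<n} y \<Longrightarrow> y < n" for y by (auto simp: cand_def win_def)
  then have "joined (Suc j) {..<n} \<longleftrightarrow> (\<exists>y < n. cand j {..<n} y \<and> joined j (right y) \<and>
     (\<forall>z < n. cand j {..<n} z \<longrightarrow> r y = r z))"
    unfolding joined_Suc[OF order_refl] by metis
  also have "\<dots> \<longleftrightarrow> (\<exists>y < n. R2 6 y y \<and> R2 4 y y \<and>
     (\<forall>z < n. R2 6 z z \<longrightarrow> \<not> R2 2 y z \<and> \<not> R2 2 z y))"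
  proof -
    have "r y = r z \<longleftrightarrow> \<not> R2 2 y z \<and> \<not> R2 2 z y" if "y < n" "z < n" for y z
      using t(1) old that by auto
    then show ?thesis using C t(2) old by metis
  qed
  also have "\<dots> \<longleftrightarrow> fval n k answer_fm e R2"
    using False by (auto simp: answer_fm_def joined_fm_def)
  finally have "fval n k answer_fm e (run n k rest 0 e R) \<longleftrightarrow> joined (Suc j) {..<n}"
    using run by simp
  also have "\<dots> \<longleftrightarrow> joined k {..<n}"
  \<comment> \<open>For \<open>k > n\<close> the rounds stop at \<open>j = n\<close>; then
    \<open>Suc j\<close> and \<open>k\<close> both exceed the number of vertices, and both sides are
    false.\<close>
  proof (cases "k \<le> n")
    case True
    then have "Suc j = k" using False by (auto simp: j_def)
    then show ?thesis by simp
  next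
    case far: False
    then have "Suc j > n" using False by (auto simp: j_def)
    then show ?thesis using far joined_bound[of "Suc j"] joined_bound[of k] by auto
  qed
  finally show ?thesis .
qed

end

text \<open>The order is that of the real intervals: one lies entirely to the left of the
  other.\<close>

lemma interval_graph_cocomparability:
  assumes "interval_graph G" "pverts G = {..<n}"
  obtains P where "cocomparability n (\<lambda>x y. (x, y) \<in> parcs G) P"
proof -
  interpret pair_graph G using assms(1) by (simp add: interval_graph_def)
  obtain I :: "nat \<Rightarrow> real set" where I: "\<And>v. v < n \<Longrightarrow> is_interval (I v)" "\<And>v. v < n \<Longrightarrow> I v \<noteq> {}"
    and adj: "\<And>u v. u < n \<Longrightarrow> v < n \<Longrightarrow> u \<noteq> v \<Longrightarrow> (u, v) \<in> parcs G \<longleftrightarrow> I u \<inter> I v \<noteq> {}"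
  proof -
    obtain I :: "nat \<Rightarrow> real set" where "\<forall>v \<in> pverts G. is_interval (I v) \<and> I v \<noteq> {}"
      "\<forall>u \<in> pverts G. \<forall>v \<in> pverts G. u \<noteq> v \<longrightarrow> ((u, v) \<in> parcs G \<longleftrightarrow> I u \<inter> I v \<noteq> {})"
      using assms(1) unfolding interval_graph_def by blast
    then show thesis using that[of I] assms(2) by simp
  qed
  define P where "P a b \<longleftrightarrow> a < n \<and> b < n \<and> (\<forall>x \<in> I a. \<forall>y \<in> I b. x < y)" for a b
  have "cocomparability n (\<lambda>x y. (x, y) \<in> parcs G) P"
  proof
    show "(a, a) \<notin> parcs G" for a using no_loops by fastforce
    show "(b, a) \<in> parcs G" if "(a, b) \<in> parcs G" for a b
      using that by (rule arcs_symmetric)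
    show "a < n \<and> b < n" if "(a, b) \<in> parcs G" for a b
      using in_arcsD1[OF that] in_arcsD2[OF that] assms(2) by auto
    show "a < n \<and> b < n \<and> a \<noteq> b \<and> (a, b) \<notin> parcs G" if "P a b" for a b
      using that I(2)[of a] adj[of a b] by (fastforce simp: P_def)
    show "P a b \<or> P b a" if ab: "a < n" "b < n" "a \<noteq> b" "(a, b) \<notin> parcs G" for a b
    proof (rule ccontr)
      assume "\<not> ?thesis"
      then obtain x y p q where xy: "x \<in> I a" "y \<in> I b" "y \<le> x" and pq: "p \<in> I b" "q \<in> I a" "q \<le> p"
        using ab(1,2) unfolding P_def by (meson not_less)
      \<comment> \<open>Either \<open>q \<le> y \<le> x\<close> or \<open>y < q \<le> p\<close>, and
        convexity gives a common point of the two intervals.\<close>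
      have "y \<in> I a \<or> q \<in> I b"
      proof (cases "q \<le> y")
        case True
        then show ?thesis using I(1)[OF that(1)] xy pq unfolding is_interval_1 by blast
      next
        case False
        then show ?thesis using I(1)[OF that(2)] xy pq unfolding is_interval_1 by (meson linear)
      qed
      then show False using adj that xy pq by blast
    qed
    show "P a d \<or> P c b" if abcd: "P a b" "P c d" for a b c d
    proof (rule ccontr)
      assume "\<not> ?thesis"
      then obtain x y p q where "x \<in> I a" "y \<in> I d" "y \<le> x" "p \<in> I c" "q \<in> I b" "q \<le> p"
        using abcd unfolding P_def by (meson not_less)
      \<comment> \<open>The contradiction is \<open>y \<le> x < q \<le> p < y\<close>.\<close>
      then show False using that unfolding P_def by fastforce
    qed
  qed
  then show thesis using that by blast
qed

theorem theorem2:
  shows "polytime_decidable graph_nat_input graph_nat_size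
           {(G :: nat pair_pre_digraph, k :: nat).
              pverts G = {..<card (pverts G)} \<and> interval_graph G}
           (\<lambda>(G, k). Digraph_Component.connected (with_proj (TS_graph k G)))"
proof -
  obtain c q where c: "\<And>s R. (\<forall>x y. x < s ''n'' 0 \<longrightarrow> y < s ''n'' 0 \<longrightarrow>
         (0 < s ''A'' (x * s ''n'' 0 + y) \<longleftrightarrow> R x y)) \<Longrightarrow>
       s ''R'' = (\<lambda>i. 0) \<Longrightarrow> (\<forall>t > 0. s (tab t) = (\<lambda>i. 0)) \<Longrightarrow>
       (\<exists>t s'. exec c s t s' \<and> t \<le> poly q (s ''n'' 0) \<and>
         s' ''out'' 0 = of_bool (fval (s ''n'' 0) (s ''k'' 0) answer_fm (\<lambda>_. 0)
           (run (s ''n'' 0) (s ''k'' 0) main_prog 0 (\<lambda>_. 0) ((\<lambda>t x y. False)(0 := R)))))"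
    using polytime_definable[OF scoped_main] by blast
  have "\<exists>t s. exec c (graph_nat_input (G, k)) t s \<and> t \<le> poly q (graph_nat_size (G, k)) \<and>
      s ''out'' 0 = (if Digraph_Component.connected (with_proj (TS_graph k G)) then 1 else 0)"
    if G: "pverts G = {..<card (pverts G)}" "interval_graph G" for G :: "nat pair_pre_digraph" and k
  proof -
    define n where "n = card (pverts G)"
    define A where "A x y \<longleftrightarrow> (x, y) \<in> parcs G" for x y
    have pv: "pverts G = {..<n}" using G(1) by (simp add: n_def)
    obtain P where "cocomparability n A P"
      unfolding A_def using interval_graph_cocomparability[OF G(2) pv] by blast
    then interpret cocomparability n A P .
    let ?s = "graph_nat_input (G, k)" and ?R0 = "(\<lambda>t x y. False)(0 := A)" and ?e = "\<lambda>_ :: nat. 0 :: nat"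
    have s: "?s ''n'' 0 = n" "?s ''k'' 0 = k" "?s ''R'' = (\<lambda>i. 0)"
      "?s ''A'' i = (if A (i div n) (i mod n) then 1 else 0)" for i
      by (simp_all add: graph_nat_input_def n_def A_def Let_def)
    have s_tab: "?s (tab t) = (\<lambda>i. 0)" if "t > 0" for t
      using that by (cases t) (simp_all add: graph_nat_input_def Let_def tab_def)
    have s_A: "0 < ?s ''A'' (x * n + y) \<longleftrightarrow> A x y" if "x < n" "y < n" for x y
      using that by (simp add: s)
    obtain t s' where ex: "exec c ?s t s'" "t \<le> poly q n"
      "s' ''out'' 0 = of_bool (fval n k answer_fm ?e (run n k main_prog 0 ?e ?R0))"
      using c[of ?s A] s s_tab s_A by auto
    define R where "R = run n k orient_prog 0 ?e ?R0"
    define D where "D = pairs (R 1)"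
    have D: "oriented ({..<n} \<times> {..<n}) D"
      unfolding D_def R_def by (rule run_orient) auto
    have D_sub: "D \<subseteq> {..<n} \<times> {..<n}" using D_non[OF D] by (auto simp: non_def)
    have irrefl: "(x, x) \<notin> D" for x using D_antisym[OF D] by blast
    obtain l r :: "nat \<Rightarrow> nat" where lr: "\<forall>v < n. l v \<le> r v"
      "\<forall>u < n. \<forall>v < n. (u, v) \<in> D \<longleftrightarrow> r u < l v"
      "\<forall>u < n. \<forall>v < n. r u < r v \<longleftrightarrow> (\<exists>z < n. (u, z) \<in> D \<and> (v, z) \<notin> D)"
      using ferrers_representation[OF D_sub irrefl D_ferrers[OF D]] by blast
    \<comment> \<open>These intervals come from the computed orientation. They may order the
      vertices differently from the given real ones, but they have the same intersection
      graph.\<close>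
    interpret numbered_intervals n l r by standard (use lr in auto)
    obtain rest where rest: "main_prog = Then orient_prog rest" unfolding main_prog_def by blast
    have "fval n k answer_fm ?e (run n k rest 0 ?e R) \<longleftrightarrow> joined k {..<n}"
      by (rule run_main[OF _ _ rest]) (use lr in \<open>auto simp: D_def pairs_def\<close>)
    moreover have "run n k main_prog 0 ?e ?R0 = run n k rest 0 ?e R"
      by (simp add: rest R_def)
    moreover have "joined k {..<n} \<longleftrightarrow> Digraph_Component.connected (with_proj (TS_graph k G))"
    proof (rule joined_iff_TS_connected[OF pv])
      fix u v
      show "(u, v) \<in> parcs G \<longleftrightarrow> u \<in> {..<n} \<and> v \<in> {..<n} \<and> u \<noteq> v \<and> l u \<le> r v \<and> l v \<le> r u"
      proof (cases "u < n \<and> v < n")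
        case True
        have "(u, v) \<in> D \<or> (v, u) \<in> D \<longleftrightarrow> (u, v) \<in> non"
          using D_total[OF D] D_non[OF D] non_sym by blast
        also have "\<dots> \<longleftrightarrow> u \<noteq> v \<and> \<not> A u v" using True by (simp add: non_def)
        finally have "A u v \<longleftrightarrow> u \<noteq> v \<and> (u, v) \<notin> D \<and> (v, u) \<notin> D" using A_irrefl by blast
        then show ?thesis using True lr(2) by (simp add: A_def not_less conj_commute)
      next
        case False
        then show ?thesis using A_verts[of u v] by (auto simp: A_def)
      qed
    qed
    moreover have "poly q n \<le> poly q (graph_nat_size (G, k))"
      \<comment> \<open>The bound in \<open>n\<close> becomes one in the input size because the
        matrix alone contributes \<open>n * n \<ge> n\<close>.\<close>
      by (rule poly_nat_mono) (cases n; simp add: graph_nat_size_def n_def Let_def)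
    ultimately show ?thesis using ex by (intro exI[of _ t] exI[of _ s']) auto
  qed
  then show ?thesis unfolding polytime_decidable_def by (intro exI[of _ c] exI[of _ q]) auto
qed

end
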